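(* Let $n\ge 1$ and let $T_-,T_+:\mathbb{Z}^n\times\mathbb{Z}^n\to\mathbb{Z}^n$ be complementing operations, i.e. $T_-(x,y)+T_+(x,y)=x+y$ for all $x,y\in\mathbb{Z}^n$, which are translation equivariant and monotone in the sense of Knothe. Suppose that $\mu$ and $\nu$ are finitely supported probability measures on $\mathbb{Z}^n$. Then there exists a coupling $\pi$ between $\mu$ and $\nu$ such that, denoting by $\kappa_-=\pi\circ T_-^{-1}$ and $\kappa_+=\pi\circ T_+^{-1}$ the push-forwards of $\pi$ by $T_-$ and $T_+$ respectively, we have $$H(\mu|m_n)+H(\nu|m_n)\ge H(\kappa_-|m_n)+H(\kappa_+|m_n).$$
   Context: $m_n$ denotes the counting measure on $\mathbb{Z}^n$, and the relative entropy of a probability measure $\mu$ on $\mathbb{Z}^n$ with respect to $m_n$ is $H(\mu|m_n)=\sum_{x\in\mathbb{Z}^n}\mu(x)\log(\mu(x))$ (with $0\log 0=0$), where $\mu(x)=\mu(\{x\})$. A coupling between probability measures $\mu$ and $\nu$ on $\mathbb{Z}^n$ is a probability measure on $\mathbb{Z}^n\times\mathbb{Z}^n$ whose first and second marginals are $\mu$ and $\nu$. An operation $T:\mathbb{Z}^n\times\mathbb{Z}^n\to\mathbb{Z}^n$ is translation equivariant if $T(x+z,y+z)=T(x,y)+z$ for all $x,y,z\in\mathbb{Z}^n$. A total additive ordering on an abelian group $G\cong\mathbb{Z}^l$ is a binary relation $\preceq$ that is reflexive, antisymmetric and transitive, such that any two elements are comparable, and such that $x\preceq y$ implies $x+z\preceq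 y+z$ for all $x,y,z\in G$. $T$ is monotone in the sense of Knothe if there exists a decomposition of $\mathbb{Z}^n$ into a direct sum of groups $\mathbb{Z}^n=G_1\times\dots\times G_k$ such that, writing $T=(T_1,\dots,T_k)$ according to this decomposition, for each $i\in\{1,\dots,k\}$: (i) $T_i(x,y)\in G_i$ depends only on the first $i$ coordinates of its arguments $x,y\in G_1\times\dots\times G_k$, so $T_i$ can be regarded as a map $(G_1\times\dots\times G_i)\times(G_1\times\dots\times G_i)\to G_i$; (ii) there exists a total additive ordering $\preceq_i$ on $G_i$ such that for all $a,b\in G_1\times\dots\times G_{i-1}$ the map $T_i^{(a,b)}:G_i\times G_i\to G_i$, $T_i^{(a,b)}(x,y)=T_i\big((a,x),(b,y)\big)$, satisfies: for all $x_1,x_2,y_1,y_2\in G_i$, if $x_1\preceq_i x_2$ and $y_1\preceq_i y_2$ then $T_i^{(a,b)}(x_1,y_1)\preceq_i T_i^{(a,b)}(x_2,y_2)$. *)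

theory Defs
  imports "HOL-Probability.Probability"
begin

text \<open>Since every subset of \<open>\<int>\<^sup>n\<close> is measurable, probability measures on \<open>\<int>\<^sup>n\<close> are rendered as
  \<open>pmf\<close>s on \<open>int ^ 'n\<close>.\<close>

text \<open>Relative entropy with respect to the counting measure. The summands are nonpositive and
  \<open>0 * ln 0 = 0\<close>. The value is the intended one whenever the series converges, in particular for
  finitely supported \<open>\<mu>\<close>; if the entropy is \<open>-\<infinity>\<close>, the real-valued \<open>infsum\<close> returns \<open>0\<close>.\<close>

definition counting_entropy :: "'a pmf \<Rightarrow> real" where
  "counting_entropy \<mu> = (\<Sum>\<^sub>\<infinity>x\<in>UNIV. pmf \<mu> x * ln (pmf \<mu> x))"

definition is_coupling :: "('a \<times> 'b) pmf \<Rightarrow> 'a pmf \<Rightarrow> 'b pmf \<Rightarrow> bool" where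
  "is_coupling \<pi> \<mu> \<nu> \<longleftrightarrow> map_pmf fst \<pi> = \<mu> \<and> map_pmf snd \<pi> = \<nu>"

definition translation_equivariant :: "('a::ab_group_add \<Rightarrow> 'a \<Rightarrow> 'a) \<Rightarrow> bool" where
  "translation_equivariant T \<longleftrightarrow> (\<forall>x y z. T (x + z) (y + z) = T x y + z)"

definition complementing :: "('a::ab_group_add \<Rightarrow> 'a \<Rightarrow> 'a) \<Rightarrow> ('a \<Rightarrow> 'a \<Rightarrow> 'a) \<Rightarrow> bool" where
  "complementing S T \<longleftrightarrow> (\<forall>x y. S x y + T x y = x + y)"

definition additive_subgroup :: "'a::ab_group_add set \<Rightarrow> bool" where
  "additive_subgroup H \<longleftrightarrow> 0 \<in> H \<and> (\<forall>x\<in>H. \<forall>y\<in>H. x + y \<in> H) \<and> (\<forall>x\<in>H. - x \<in> H)"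

definition total_additive_ordering :: "'a::ab_group_add set \<Rightarrow> ('a \<times> 'a) set \<Rightarrow> bool" where
  "total_additive_ordering H r \<longleftrightarrow>
     linear_order_on H r \<and>
     (\<forall>x\<in>H. \<forall>y\<in>H. \<forall>z\<in>H. (x, y) \<in> r \<longrightarrow> (x + z, y + z) \<in> r)"

text \<open>Internal direct sum of the subgroups \<open>G 1, \<dots>, G k\<close>. Subgroups of \<open>\<int>\<^sup>n\<close> are free abelian of
  finite rank, so \<open>G i \<cong> \<int>\<^sup>l\<close> holds automatically.\<close>

definition direct_sum_decomposition :: "nat \<Rightarrow> (nat \<Rightarrow> 'a::ab_group_add set) \<Rightarrow> bool" where
  "direct_sum_decomposition k G \<longleftrightarrow>
     (\<forall>i\<in>{1..k}. additive_subgroup (G i)) \<and>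
     (\<forall>x. \<exists>!g. g \<in> Pi\<^sub>E {1..k} G \<and> x = (\<Sum>i=1..k. g i))"

definition component :: "nat \<Rightarrow> (nat \<Rightarrow> 'a::ab_group_add set) \<Rightarrow> nat \<Rightarrow> 'a \<Rightarrow> 'a" where
  "component k G i x = (THE g. g \<in> Pi\<^sub>E {1..k} G \<and> x = (\<Sum>j=1..k. g j)) i"

text \<open>\<open>G 1 \<times> \<dots> \<times> G (i - 1)\<close> as a subgroup of the ambient group; it is \<open>{0}\<close> for \<open>i = 1\<close>.\<close>

definition partial_sums_below :: "(nat \<Rightarrow> 'a::ab_group_add set) \<Rightarrow> nat \<Rightarrow> 'a set" where
  "partial_sums_below G i = (\<lambda>g. \<Sum>j\<in>{1..<i}. g j) ` Pi {1..<i} G"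

text \<open>The map \<open>T\<^sub>i\<close> is \<open>\<lambda>x y. component k G i (T x y)\<close>. In the monotonicity clause the pair \<open>(a, x)\<close>
  with \<open>x \<in> G i\<close> is the element \<open>a + x\<close>, whose components after the \<open>i\<close>-th are zero; by the first
  clause these later components are irrelevant.\<close>

definition knothe_monotone :: "('a::ab_group_add \<Rightarrow> 'a \<Rightarrow> 'a) \<Rightarrow> bool" where
  "knothe_monotone T \<longleftrightarrow>
     (\<exists>k G. direct_sum_decomposition k G \<and>
       (\<forall>i\<in>{1..k}.
         (\<forall>x x' y y'.
            (\<forall>j\<in>{1..i}. component k G j x = component k G j x' \<and>
                        component k G j y = component k G j y') \<longrightarrow>
            component k G i (T x y) = component k G i (T x' y')) \<and>
         (\<exists>r. total_additive_ordering (G i) r \<and>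
            (\<forall>a\<in>partial_sums_below G i. \<forall>b\<in>partial_sums_below G i.
               \<forall>x1\<in>G i. \<forall>x2\<in>G i. \<forall>y1\<in>G i. \<forall>y2\<in>G i.
                 (x1, x2) \<in> r \<longrightarrow> (y1, y2) \<in> r \<longrightarrow>
                 (component k G i (T (a + x1) (b + y1)),
                  component k G i (T (a + x2) (b + y2))) \<in> r))))"

end

theory Submission
  imports Defs
begin

text \<open>Write \<open>h = - counting_entropy\<close> for Shannon entropy. The claim is that some coupling \<open>(X, Y)\<close> satisfies
  \<open>h(T\<^sub>-) + h(T\<^sub>+) \<ge> h(X) + h(Y)\<close>.

  Suppose first that the group itself carries a total additive ordering for which \<open>T\<^sub>-\<close> is monotone.
  Since \<open>T\<^sub>+ = X + Y - T\<^sub>-\<close>, equivariance makes \<open>T\<^sub>+\<close> monotone as well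
  (\<open>level_monotone_complement\<close>). Take the monotone coupling, whose support is a chain
  (\<open>monotone_coupling\<close>). By equivariance, \<open>T\<^sub>\<plusminus>\<close> increases strictly when both arguments do
  (\<open>strict_level_increase\<close>), so two support points with equal \<open>T\<^sub>-\<close> share \<open>X\<close> or share \<open>Y\<close>.
  Therefore every fibre of \<open>T\<^sub>-\<close> lies in a line \<open>X = const\<close> or in a line \<open>Y = const\<close>, and \<open>X\<close> and \<open>Y\<close>
  are conditionally independent given \<open>T\<^sub>-\<close> (\<open>counting_entropy_split_fibres\<close>):
  \<open>h(T\<^sub>-) + h(X, Y) = h(T\<^sub>-, X) + h(T\<^sub>-, Y)\<close>. The same holds for \<open>T\<^sub>+\<close>. As
  \<open>(T\<^sub>-, T\<^sub>+, X)\<close> determines \<open>Y\<close>, submodularity gives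
  \<open>h(T\<^sub>-, X) + h(T\<^sub>+, X) \<ge> h(X, Y) + h(X)\<close>, and similarly with \<open>X\<close> and \<open>Y\<close> exchanged. Adding up, the
  terms \<open>h(X, Y)\<close> cancel (\<open>counting_entropy_exchange\<close>).

  For several summands the Knothe coupling is built one summand at a time (\<open>knothe_gluing\<close>):
  conditionally on the first \<open>i\<close> components \<open>C\<close> of \<open>X\<close> and \<open>Y\<close>, the next components are coupled
  monotonically. The argument above applies conditionally on \<open>C\<close>, and the chain rule passes to the
  first \<open>i + 1\<close> components (\<open>entropy_level_step\<close>): the next component of \<open>X\<close> depends on \<open>C\<close> only
  through the first components of \<open>X\<close>, and those of \<open>T\<^sub>\<plusminus>\<close> are functions of \<open>C\<close>, so conditioning on them
  rather than on \<open>C\<close> can only increase the entropy.\<close>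

section \<open>Entropy of variables on a finite probability space\<close>

lemma pmf_map_finite:
  assumes "finite (set_pmf p)"
  shows "pmf (map_pmf f p) y = (\<Sum>\<omega> | \<omega> \<in> set_pmf p \<and> f \<omega> = y. pmf p \<omega>)"
proof -
  have "pmf (map_pmf f p) y = measure p (f -` {y})"
    by (simp add: pmf_map)
  also have "\<dots> = measure p (f -` {y} \<inter> set_pmf p)"
    by (rule measure_Int_set_pmf[symmetric])
  also have "\<dots> = (\<Sum>\<omega>\<in>f -` {y} \<inter> set_pmf p. pmf p \<omega>)"
    using assms by (intro measure_measure_pmf_finite) auto
  also have "f -` {y} \<inter> set_pmf p = {\<omega>. \<omega> \<in> set_pmf p \<and> f \<omega> = y}"
    by auto
  finally show ?thesis .
qed

lemma sum_pmf_map_finite: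
  fixes g :: "'b \<Rightarrow> real"
  assumes "finite (set_pmf p)"
  shows "(\<Sum>y\<in>set_pmf (map_pmf f p). pmf (map_pmf f p) y * g y) = (\<Sum>\<omega>\<in>set_pmf p. pmf p \<omega> * g (f \<omega>))"
proof -
  have "(\<Sum>\<omega>\<in>set_pmf p. pmf p \<omega> * g (f \<omega>)) =
        (\<Sum>y\<in>f ` set_pmf p. \<Sum>\<omega> | \<omega> \<in> set_pmf p \<and> f \<omega> = y. pmf p \<omega> * g (f \<omega>))"
    by (rule sum.image_gen[OF assms])
  also have "\<dots> = (\<Sum>y\<in>set_pmf (map_pmf f p). pmf (map_pmf f p) y * g y)"
    unfolding set_map_pmf pmf_map_finite[OF assms] sum_distrib_right
    by (intro sum.cong) auto
  finally show ?thesis by simp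
qed

lemma counting_entropy_finite:
  assumes "finite (set_pmf p)"
  shows "counting_entropy p = (\<Sum>x\<in>set_pmf p. pmf p x * ln (pmf p x))"
proof -
  have "counting_entropy p = (\<Sum>\<^sub>\<infinity>x\<in>set_pmf p. pmf p x * ln (pmf p x))"
    unfolding counting_entropy_def
    by (rule infsum_cong_neutral) (auto simp: set_pmf_iff)
  then show ?thesis using assms by simp
qed

text \<open>Variables on a common finite probability space are compared by writing their entropies as
  averages over that space. In this form, (in)equalities between entropies of different variables
  reduce to statements about the masses of the fibres through each sample point.\<close>

lemma counting_entropy_map:
  assumes "finite (set_pmf p)"
  shows "counting_entropy (map_pmf f p) =
    (\<Sum>\<omega>\<in>set_pmf p. pmf p \<omega> * ln (pmf (map_pmf f p) (f \<omega>)))"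
  using assms sum_pmf_map_finite[OF assms, of f "\<lambda>y. ln (pmf (map_pmf f p) y)"]
  by (simp add: counting_entropy_finite)

lemma pmf_map_fibre_cong:
  assumes "finite (set_pmf p)"
    and "\<And>\<omega>'. \<omega>' \<in> set_pmf p \<Longrightarrow> f \<omega>' = f \<omega> \<longleftrightarrow> g \<omega>' = g \<omega>"
  shows "pmf (map_pmf f p) (f \<omega>) = pmf (map_pmf g p) (g \<omega>)"
  unfolding pmf_map_finite[OF assms(1)] using assms(2) by (intro sum.cong) auto

text \<open>Entropy sees a variable only through the partition into its fibres, so variables that determine
  each other can be exchanged freely.\<close>

lemma counting_entropy_cong:
  assumes "finite (set_pmf p)"
    and "\<And>\<omega> \<omega>'. \<omega> \<in> set_pmf p \<Longrightarrow> \<omega>' \<in> set_pmf p \<Longrightarrow> f \<omega> = f \<omega>' \<longleftrightarrow> g \<omega> = g \<omega>'"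
  shows "counting_entropy (map_pmf f p) = counting_entropy (map_pmf g p)"
proof -
  have "pmf (map_pmf f p) (f \<omega>) = pmf (map_pmf g p) (g \<omega>)" if "\<omega> \<in> set_pmf p" for \<omega>
    using assms that by (intro pmf_map_fibre_cong) auto
  then show ?thesis
    unfolding counting_entropy_map[OF assms(1)] by (intro sum.cong) auto
qed

lemma pmf_map_pos: "\<omega> \<in> set_pmf p \<Longrightarrow> 0 < pmf (map_pmf f p) (f \<omega>)"
  by (intro pmf_positive) auto

text \<open>Conditional independence enters the entropy computations in this form, as an identity between
  products of fibre masses.\<close>

lemma counting_entropy_modular:
  assumes "finite (set_pmf p)"
    and "\<And>\<omega>. \<omega> \<in> set_pmf p \<Longrightarrow>
      pmf (map_pmf f p) (f \<omega>) * pmf (map_pmf g p) (g \<omega>) =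
      pmf (map_pmf h p) (h \<omega>) * pmf (map_pmf k p) (k \<omega>)"
  shows "counting_entropy (map_pmf f p) + counting_entropy (map_pmf g p) =
    counting_entropy (map_pmf h p) + counting_entropy (map_pmf k p)"
proof -
  have "ln (pmf (map_pmf f p) (f \<omega>)) + ln (pmf (map_pmf g p) (g \<omega>)) =
        ln (pmf (map_pmf h p) (h \<omega>)) + ln (pmf (map_pmf k p) (k \<omega>))" if "\<omega> \<in> set_pmf p" for \<omega>
    using that assms(2)[OF that] by (metis ln_mult_pos pmf_map_pos)
  then show ?thesis
    unfolding counting_entropy_map[OF assms(1)] sum.distrib[symmetric]
    by (intro sum.cong) (auto simp: distrib_left[symmetric])
qed

lemma sum_pmf_fst:
  assumes "finite (set_pmf q)" and "finite U" and "fst ` set_pmf q \<subseteq> U"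
  shows "(\<Sum>u\<in>U. pmf q (u, w)) = pmf (map_pmf snd q) w"
proof -
  have "(\<Sum>u\<in>U. pmf q (u, w)) = (\<Sum>z\<in>(\<lambda>u. (u, w)) ` U. pmf q z)"
    by (subst sum.reindex) (auto simp: inj_on_def)
  also have "\<dots> = (\<Sum>z | z \<in> set_pmf q \<and> snd z = w. pmf q z)"
    using assms by (intro sum.mono_neutral_right) (force simp: set_pmf_iff)+
  finally show ?thesis by (simp add: pmf_map_finite[OF assms(1)])
qed

text \<open>Nonnegativity of conditional mutual information. By \<open>ln x \<le> x - 1\<close> it is enough
  that the density \<open>r(u,w) s(v,w) / t(w)\<close>, under which \<open>u\<close> and
  \<open>v\<close> are conditionally independent given \<open>w\<close>, has total mass at most
  \<open>1\<close>.\<close>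

lemma counting_entropy_supermodular_triple:
  fixes q :: "('u \<times> 'v \<times> 'w) pmf"
  assumes fin: "finite (set_pmf q)"
  defines "r \<equiv> map_pmf (\<lambda>z. (fst z, snd (snd z))) q"
    and "s \<equiv> map_pmf snd q"
    and "t \<equiv> map_pmf (\<lambda>z. snd (snd z)) q"
  shows "counting_entropy r + counting_entropy s \<le> counting_entropy q + counting_entropy t"
proof -
  define U where "U = fst ` set_pmf q"
  define V where "V = (fst \<circ> snd) ` set_pmf q"
  define W where "W = (snd \<circ> snd) ` set_pmf q"
  have finUVW: "finite U" "finite V" "finite W"
    using fin by (auto simp: U_def V_def W_def)
  have sub: "set_pmf q \<subseteq> U \<times> V \<times> W"
    by (force simp: U_def V_def W_def)
  have r_sum: "(\<Sum>u\<in>U. pmf r (u, w)) = pmf t w" for w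
  proof -
    have "map_pmf snd r = t"
      by (simp add: r_def t_def map_pmf_comp)
    moreover have "finite (set_pmf r)" "fst ` set_pmf r \<subseteq> U"
      using fin by (force simp: r_def U_def)+
    ultimately show ?thesis using sum_pmf_fst[of r U w] finUVW by simp
  qed
  have s_sum: "(\<Sum>v\<in>V. pmf s (v, w)) = pmf t w" for w
  proof -
    have "map_pmf snd s = t"
      by (simp add: s_def t_def map_pmf_comp)
    moreover have "finite (set_pmf s)" "fst ` set_pmf s \<subseteq> V"
      using fin by (force simp: s_def V_def)+
    ultimately show ?thesis using sum_pmf_fst[of s V w] finUVW by simp
  qed
  define R where
    "R z = pmf r (fst z, snd (snd z)) * pmf s (snd z) / pmf t (snd (snd z))" for z
  have R_sum: "(\<Sum>z\<in>set_pmf q. R z) \<le> 1"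
  proof -
    have "(\<Sum>z\<in>set_pmf q. R z) \<le> (\<Sum>z\<in>U \<times> V \<times> W. R z)"
      using finUVW sub by (intro sum_mono2) (auto simp: R_def)
    also have "\<dots> = (\<Sum>u\<in>U. \<Sum>v\<in>V. \<Sum>w\<in>W. R (u, v, w))"
      by (simp add: sum.cartesian_product split_def)
    also have "\<dots> = (\<Sum>w\<in>W. \<Sum>u\<in>U. \<Sum>v\<in>V. R (u, v, w))"
      by (subst sum.swap[of _ W V]) (subst sum.swap[of _ W U], rule refl)
    also have "\<dots> = (\<Sum>w\<in>W. pmf t w * pmf t w / pmf t w)"
    proof (rule sum.cong[OF refl])
      fix w
      have "(\<Sum>u\<in>U. \<Sum>v\<in>V. R (u, v, w)) =
          (\<Sum>u\<in>U. pmf r (u, w)) * (\<Sum>v\<in>V. pmf s (v, w)) / pmf t w"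
        unfolding sum_product sum_divide_distrib by (simp add: R_def)
      then show "(\<Sum>u\<in>U. \<Sum>v\<in>V. R (u, v, w)) = pmf t w * pmf t w / pmf t w"
        by (simp only: r_sum s_sum)
    qed
    also have "\<dots> = (\<Sum>w\<in>W. pmf t w)"
      by (intro sum.cong) auto
    also have "\<dots> \<le> 1"
      using finUVW by (simp add: measure_measure_pmf_finite[symmetric])
    finally show ?thesis .
  qed
  have "counting_entropy r + counting_entropy s - counting_entropy q - counting_entropy t =
    (\<Sum>z\<in>set_pmf q. pmf q z * (ln (pmf r (fst z, snd (snd z))) + ln (pmf s (snd z))
      - ln (pmf q z) - ln (pmf t (snd (snd z)))))"
    unfolding r_def s_def t_def counting_entropy_map[OF fin] counting_entropy_finite[OF fin]
      distrib_left right_diff_distrib sum.distrib sum_subtractf ..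
  also have "\<dots> \<le> (\<Sum>z\<in>set_pmf q. R z - pmf q z)"
  proof (rule sum_mono)
    fix z assume z: "z \<in> set_pmf q"
    define \<alpha> \<beta> \<gamma> \<delta> where "\<alpha> = pmf r (fst z, snd (snd z))" and "\<beta> = pmf s (snd z)"
      and "\<gamma> = pmf q z" and "\<delta> = pmf t (snd (snd z))"
    have pos: "0 < \<alpha>" "0 < \<beta>" "0 < \<gamma>" "0 < \<delta>"
      using pmf_map_pos[OF z, of "\<lambda>z. (fst z, snd (snd z))"] pmf_map_pos[OF z, of snd]
        pmf_map_pos[OF z, of "\<lambda>z. snd (snd z)"] pmf_positive[OF z]
      by (simp_all add: \<alpha>_def \<beta>_def \<gamma>_def \<delta>_def r_def s_def t_def)
    then have "ln \<alpha> + ln \<beta> - ln \<gamma> - ln \<delta> = ln ((\<alpha> * \<beta>) / (\<gamma> * \<delta>))"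
      by (simp add: ln_mult_pos ln_divide_pos)
    also have "\<dots> \<le> (\<alpha> * \<beta>) / (\<gamma> * \<delta>) - 1"
      using pos by (intro ln_le_minus_one) simp
    finally have "\<gamma> * (ln \<alpha> + ln \<beta> - ln \<gamma> - ln \<delta>) \<le> \<gamma> * ((\<alpha> * \<beta>) / (\<gamma> * \<delta>) - 1)"
      using pos by (intro mult_left_mono) auto
    also have "\<dots> = \<alpha> * \<beta> / \<delta> - \<gamma>"
      using pos by (simp add: field_simps)
    finally show "pmf q z * (ln (pmf r (fst z, snd (snd z))) + ln (pmf s (snd z))
      - ln (pmf q z) - ln (pmf t (snd (snd z)))) \<le> R z - pmf q z"
      by (simp add: R_def \<alpha>_def \<beta>_def \<gamma>_def \<delta>_def)
  qed
  also have "\<dots> \<le> 0"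
    using R_sum fin by (simp add: sum_subtractf sum_pmf_eq_1)
  finally show ?thesis by simp
qed

text \<open>The same inequality for variables \<open>f\<close> and \<open>g\<close> that both determine
  \<open>m\<close>, with \<open>j\<close> any variable equivalent to the pair. Since it is stated
  through fibres, it applies without rearranging tuples.\<close>

lemma counting_entropy_supermodular:
  assumes fin: "finite (set_pmf p)"
    and j: "\<And>\<omega> \<omega>'. \<omega> \<in> set_pmf p \<Longrightarrow> \<omega>' \<in> set_pmf p \<Longrightarrow> j \<omega> = j \<omega>' \<longleftrightarrow> f \<omega> = f \<omega>' \<and> g \<omega> = g \<omega>'"
    and mf: "\<And>\<omega> \<omega>'. \<omega> \<in> set_pmf p \<Longrightarrow> \<omega>' \<in> set_pmf p \<Longrightarrow> f \<omega> = f \<omega>' \<Longrightarrow> m \<omega> = m \<omega>'"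
    and mg: "\<And>\<omega> \<omega>'. \<omega> \<in> set_pmf p \<Longrightarrow> \<omega>' \<in> set_pmf p \<Longrightarrow> g \<omega> = g \<omega>' \<Longrightarrow> m \<omega> = m \<omega>'"
  shows "counting_entropy (map_pmf f p) + counting_entropy (map_pmf g p) \<le>
    counting_entropy (map_pmf j p) + counting_entropy (map_pmf m p)"
proof -
  define q where "q = map_pmf (\<lambda>\<omega>. (f \<omega>, g \<omega>, m \<omega>)) p"
  have "counting_entropy (map_pmf (\<lambda>\<omega>. (f \<omega>, m \<omega>)) p) + counting_entropy (map_pmf (\<lambda>\<omega>. (g \<omega>, m \<omega>)) p)
    \<le> counting_entropy (map_pmf (\<lambda>\<omega>. (f \<omega>, g \<omega>, m \<omega>)) p) + counting_entropy (map_pmf m p)"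
    using counting_entropy_supermodular_triple[of q] fin by (simp add: q_def map_pmf_comp)
  moreover have "counting_entropy (map_pmf f p) = counting_entropy (map_pmf (\<lambda>\<omega>. (f \<omega>, m \<omega>)) p)"
    by (rule counting_entropy_cong[OF fin]) (use mf in blast)
  moreover have "counting_entropy (map_pmf g p) = counting_entropy (map_pmf (\<lambda>\<omega>. (g \<omega>, m \<omega>)) p)"
    by (rule counting_entropy_cong[OF fin]) (use mg in blast)
  moreover have "counting_entropy (map_pmf j p) = counting_entropy (map_pmf (\<lambda>\<omega>. (f \<omega>, g \<omega>, m \<omega>)) p)"
    by (rule counting_entropy_cong[OF fin]) (use j mf in blast)
  ultimately show ?thesis by simp
qed

section \<open>Monotone couplings\<close>

lemma total_preorder_finite_least:
  assumes "finite A" and "A \<noteq> {}"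
    and total: "\<And>x y. le x y \<or> le y x"
    and trans: "\<And>x y z. le x y \<Longrightarrow> le y z \<Longrightarrow> le x z"
  shows "\<exists>a\<in>A. \<forall>x\<in>A. le a x"
  using assms(1,2)
proof (induction A rule: finite_ne_induct)
  case (singleton x)
  then show ?case using total by blast
next
  case (insert x F)
  then show ?case using total trans by (metis insert_iff)
qed

text \<open>The north-west corner rule: match the least points \<open>a\<close> and \<open>b\<close> with as
  much mass as both allow, which exhausts one of them, and go on with the remaining mass. As the
  first pair lies below all later ones, the support is a chain. Weights may be \<open>0\<close>,
  so a tie needs no separate case: the other point stays with weight \<open>0\<close>.\<close>

lemma monotone_transport_plan:
  fixes p q :: "'a \<Rightarrow> real"
  assumes fin: "finite A" "finite B"
    and nonneg: "\<And>x. x \<in> A \<Longrightarrow> 0 \<le> p x" "\<And>y. y \<in> B \<Longrightarrow> 0 \<le> q y"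
    and mass: "sum p A = sum q B"
    and total: "\<And>x y. le x y \<or> le y x"
    and trans: "\<And>x y z. le x y \<Longrightarrow> le y z \<Longrightarrow> le x z"
  shows "\<exists>w. (\<forall>x y. 0 \<le> w x y) \<and> (\<forall>x y. w x y \<noteq> 0 \<longrightarrow> x \<in> A \<and> y \<in> B) \<and>
    (\<forall>x\<in>A. (\<Sum>y\<in>B. w x y) = p x) \<and> (\<forall>y\<in>B. (\<Sum>x\<in>A. w x y) = q y) \<and>
    (\<forall>x y x' y'. w x y \<noteq> 0 \<longrightarrow> w x' y' \<noteq> 0 \<longrightarrow> le x x' \<and> le y y' \<or> le x' x \<and> le y' y)"
    (is "\<exists>w. ?plan w A B p q")
  using fin nonneg mass
proof (induction "card A + card B" arbitrary: A B p q rule: less_induct)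
  case less
  note finA = less.prems(1) and finB = less.prems(2)
  \<comment> \<open>Stated for all data of the same size, so that it can also be applied with the two sides swapped.\<close>
  have exhaust: "\<exists>w. ?plan w A' B' p' q'"
    if fin': "finite A'" "finite B'" and card': "card A' + card B' = card A + card B"
      and p': "\<And>x. x \<in> A' \<Longrightarrow> 0 \<le> p' x" and q': "\<And>y. y \<in> B' \<Longrightarrow> 0 \<le> q' y"
      and mass': "sum p' A' = sum q' B'"
      and a: "a \<in> A'" "\<forall>x\<in>A'. le a x" and b: "b \<in> B'" "\<forall>y\<in>B'. le b y"
      and pq: "p' a \<le> q' b"
    for A' B' a b and p' q' :: "'a \<Rightarrow> real"
  proof -
    define q'' where "q'' = q'(b := q' b - p' a)"
    have "sum q'' B' = sum q' B' - p' a"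
      using fin' b by (simp add: q''_def sum.remove[of B' b])
    moreover have "sum p' (A' - {a}) = sum p' A' - p' a"
      using fin' a by (simp add: sum.remove[of A' a])
    moreover have "card (A' - {a}) + card B' < card A + card B"
      using card' fin' a by (metis add_less_mono1 card_Diff1_less)
    moreover have "0 \<le> q'' y" if "y \<in> B'" for y
      using that q' pq by (simp add: q''_def)
    ultimately have "\<exists>w. ?plan w (A' - {a}) B' p' q''"
      using fin' p' mass' by (intro less.hyps) auto
    then obtain w where w: "?plan w (A' - {a}) B' p' q''" ..
    have w_a: "w a y = 0" for y
      using w by blast
    define v where "v = (\<lambda>x y. if x = a \<and> y = b then p' a else w x y)"
    have "?plan v A' B' p' q'"
    proof (intro conjI allI ballI impI)
      show "0 \<le> v x y" for x y
        using w p' a by (simp add: v_def)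
      show "x \<in> A'" if "v x y \<noteq> 0" for x y
        using that w a by (auto simp: v_def split: if_splits)
      show "y \<in> B'" if "v x y \<noteq> 0" for x y
        using that w b by (auto simp: v_def split: if_splits)
      show "(\<Sum>y\<in>B'. v x y) = p' x" if "x \<in> A'" for x
      proof (cases "x = a")
        case True
        then have "(\<Sum>y\<in>B'. v x y) = (\<Sum>y\<in>B'. if y = b then p' a else 0)"
          using w_a by (intro sum.cong) (auto simp: v_def)
        then show ?thesis using True fin' b by simp
      next
        case False
        then show ?thesis using w that by (simp add: v_def)
      qed
      show "(\<Sum>x\<in>A'. v x y) = q' y" if "y \<in> B'" for y
      proof -
        have "(\<Sum>x\<in>A'. v x y) = v a y + (\<Sum>x\<in>A' - {a}. v x y)"
          using fin' a by (simp add: sum.remove)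
        also have "(\<Sum>x\<in>A' - {a}. v x y) = (\<Sum>x\<in>A' - {a}. w x y)"
          by (intro sum.cong) (auto simp: v_def)
        also have "\<dots> = q'' y"
          using w that by blast
        finally show ?thesis
          using w_a by (simp add: v_def q''_def)
      qed
      show "le x x' \<and> le y y' \<or> le x' x \<and> le y' y" if "v x y \<noteq> 0" "v x' y' \<noteq> 0" for x y x' y'
      proof -
        have in_w: "w x y \<noteq> 0 \<or> x = a \<and> y = b" "w x' y' \<noteq> 0 \<or> x' = a \<and> y' = b"
          using that by (auto simp: v_def split: if_splits)
        have le_all: "le a x \<and> le b y" if "w x y \<noteq> 0 \<or> x = a \<and> y = b" for x y
          using that w a b by blast
        show ?thesis using in_w le_all w by metis
      qed
    qed
    then show ?thesis by blast
  qed
  show ?case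
  proof (cases "A = {} \<or> B = {}")
    case True
    then have zero: "(\<forall>x\<in>A. p x = 0) \<and> (\<forall>y\<in>B. q y = 0)"
      using less.prems by (metis empty_iff sum.empty sum_nonneg_eq_0_iff)
    show ?thesis by (rule exI[of _ "\<lambda>_ _. 0"]) (use zero in auto)
  next
    case False
    then have "\<exists>a\<in>A. \<forall>x\<in>A. le a x" "\<exists>b\<in>B. \<forall>y\<in>B. le b y"
      using finA finB
      by (auto intro!: total_preorder_finite_least total elim: trans)
    then obtain a b where a: "a \<in> A" "\<forall>x\<in>A. le a x" and b: "b \<in> B" "\<forall>y\<in>B. le b y"
      by blast
    show ?thesis
    proof (cases "p a \<le> q b")
      case True
      show ?thesis
        by (rule exhaust[where a = a and b = b and p' = p and q' = q]) (use less.prems a b True in auto)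
    next
      case False
      have "\<exists>w. ?plan w B A q p"
        by (rule exhaust[where a = b and b = a and p' = q and q' = p]) (use less.prems a b False in auto)
      then obtain w where w: "?plan w B A q p" ..
      show ?thesis
        by (rule exI[of _ "\<lambda>x y. w y x"]) (use w in blast)
    qed
  qed
qed

lemma exists_pmf_of_finite_mass:
  fixes w :: "'a \<Rightarrow> real"
  assumes "finite A" and "\<And>x. 0 \<le> w x" and "\<And>x. w x \<noteq> 0 \<Longrightarrow> x \<in> A" and "sum w A = 1"
  shows "\<exists>p. pmf p = w"
proof -
  have "(\<integral>\<^sup>+x. ennreal (w x) \<partial>count_space UNIV) = (\<Sum>x\<in>A. ennreal (w x))"
    using assms by (intro nn_integral_count_space'[of A]) force+
  then have "(\<integral>\<^sup>+x. ennreal (w x) \<partial>count_space UNIV) = 1"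
    using assms by (simp add: sum_ennreal)
  then have "pmf (embed_pmf w) = w"
    using assms by (intro ext pmf_embed_pmf) auto
  then show ?thesis ..
qed

lemma monotone_coupling:
  fixes P Q :: "'a pmf"
  assumes fin: "finite (set_pmf P)" "finite (set_pmf Q)"
    and total: "\<And>x y. le x y \<or> le y x"
    and trans: "\<And>x y z. le x y \<Longrightarrow> le y z \<Longrightarrow> le x z"
  shows "\<exists>\<pi>. is_coupling \<pi> P Q \<and>
    (\<forall>x y x' y'. (x, y) \<in> set_pmf \<pi> \<longrightarrow> (x', y') \<in> set_pmf \<pi> \<longrightarrow>
      le x x' \<and> le y y' \<or> le x' x \<and> le y' y)"
proof -
  let ?A = "set_pmf P" and ?B = "set_pmf Q"
  have mass: "sum (pmf P) ?A = sum (pmf Q) ?B"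
    using fin by (simp add: sum_pmf_eq_1)
  have "\<exists>w. (\<forall>x y. 0 \<le> w x y) \<and> (\<forall>x y. w x y \<noteq> 0 \<longrightarrow> x \<in> ?A \<and> y \<in> ?B) \<and>
    (\<forall>x\<in>?A. (\<Sum>y\<in>?B. w x y) = pmf P x) \<and> (\<forall>y\<in>?B. (\<Sum>x\<in>?A. w x y) = pmf Q y) \<and>
    (\<forall>x y x' y'. w x y \<noteq> 0 \<longrightarrow> w x' y' \<noteq> 0 \<longrightarrow> le x x' \<and> le y y' \<or> le x' x \<and> le y' y)"
    by (rule monotone_transport_plan; (rule fin mass total pmf_nonneg | erule (1) trans))
  then obtain w where w_nonneg: "\<forall>x y. 0 \<le> w x y"
    and w_supp: "\<forall>x y. w x y \<noteq> 0 \<longrightarrow> x \<in> ?A \<and> y \<in> ?B"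
    and w_fst: "\<forall>x\<in>?A. (\<Sum>y\<in>?B. w x y) = pmf P x"
    and w_snd: "\<forall>y\<in>?B. (\<Sum>x\<in>?A. w x y) = pmf Q y"
    and w_mono: "\<forall>x y x' y'. w x y \<noteq> 0 \<longrightarrow> w x' y' \<noteq> 0 \<longrightarrow> le x x' \<and> le y y' \<or> le x' x \<and> le y' y"
    by (elim exE conjE)
  have "(\<Sum>z\<in>?A \<times> ?B. w (fst z) (snd z)) = (\<Sum>x\<in>?A. \<Sum>y\<in>?B. w x y)"
    by (simp add: sum.cartesian_product split_def)
  also have "\<dots> = 1"
    using fin w_fst by (simp add: sum_pmf_eq_1)
  finally have total_mass: "(\<Sum>z\<in>?A \<times> ?B. w (fst z) (snd z)) = 1" .
  have "\<exists>\<pi>. pmf \<pi> = (\<lambda>z. w (fst z) (snd z))"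
    using fin w_nonneg w_supp total_mass
    by (intro exists_pmf_of_finite_mass[of "?A \<times> ?B"]) (auto simp: mem_Times_iff)
  then obtain \<pi> where \<pi>: "pmf \<pi> = (\<lambda>z. w (fst z) (snd z))" ..
  have supp: "set_pmf \<pi> \<subseteq> ?A \<times> ?B"
    using w_supp by (auto simp: set_pmf_iff \<pi>)
  have fin_\<pi>: "finite (set_pmf \<pi>)"
    using supp fin by (meson finite_SigmaI finite_subset)
  have snd_\<pi>: "pmf (map_pmf snd \<pi>) y = (\<Sum>x\<in>?A. w x y)" for y
    by (subst sum_pmf_fst[OF fin_\<pi> fin(1), symmetric]) (use supp in \<open>auto simp: \<pi>\<close>)
  have fst_\<pi>: "pmf (map_pmf fst \<pi>) x = (\<Sum>y\<in>?B. w x y)" for x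
  proof -
    have "(\<Sum>z | z \<in> set_pmf \<pi> \<and> fst z = x. pmf \<pi> z) = (\<Sum>z\<in>Pair x ` ?B. pmf \<pi> z)"
      using fin supp by (intro sum.mono_neutral_left) (force simp: set_pmf_iff)+
    also have "\<dots> = (\<Sum>y\<in>?B. w x y)"
      by (subst sum.reindex) (auto simp: inj_on_def \<pi>)
    finally show ?thesis by (simp add: pmf_map_finite[OF fin_\<pi>])
  qed
  have "map_pmf fst \<pi> = P"
  proof (rule pmf_eqI)
    fix x show "pmf (map_pmf fst \<pi>) x = pmf P x"
    proof (cases "x \<in> ?A")
      case False
      then have "(\<Sum>y\<in>?B. w x y) = 0" using w_supp by (intro sum.neutral) blast
      with False show ?thesis by (simp add: fst_\<pi> set_pmf_iff)
    qed (simp add: fst_\<pi> w_fst)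
  qed
  moreover have "map_pmf snd \<pi> = Q"
  proof (rule pmf_eqI)
    fix y show "pmf (map_pmf snd \<pi>) y = pmf Q y"
    proof (cases "y \<in> ?B")
      case False
      then have "(\<Sum>x\<in>?A. w x y) = 0" using w_supp by (intro sum.neutral) blast
      with False show ?thesis by (simp add: snd_\<pi> set_pmf_iff)
    qed (simp add: snd_\<pi> w_snd)
  qed
  moreover have "\<forall>x y x' y'. (x, y) \<in> set_pmf \<pi> \<longrightarrow> (x', y') \<in> set_pmf \<pi> \<longrightarrow>
      le x x' \<and> le y y' \<or> le x' x \<and> le y' y"
    using w_mono by (simp add: set_pmf_iff \<pi>)
  ultimately show ?thesis unfolding is_coupling_def by blast
qed

lemma pmf_map_bind_dependent_pair:
  assumes fin: "finite (set_pmf N)"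
  shows "pmf (bind_pmf N (\<lambda>z. map_pmf (Pair z) (K z))) (z, x) = pmf N z * pmf (K z) x"
proof -
  have inner: "pmf (map_pmf (Pair z') (K z')) (z, x) = (if z' = z then pmf (K z) x else 0)" for z'
  proof (cases "z' = z")
    case True
    then show ?thesis by (simp add: pmf_map_inj' inj_def)
  next
    case False
    then have "(z, x) \<notin> set_pmf (map_pmf (Pair z') (K z'))" by auto
    then show ?thesis using False by (simp only: set_pmf_iff) simp
  qed
  have "pmf (bind_pmf N (\<lambda>z. map_pmf (Pair z) (K z))) (z, x) =
      (\<Sum>z'\<in>insert z (set_pmf N). (if z' = z then pmf (K z) x else 0) * pmf N z')"
    unfolding pmf_bind inner using fin by (intro integral_measure_pmf_real) auto
  also have "\<dots> = (\<Sum>z'\<in>insert z (set_pmf N). if z' = z then pmf N z * pmf (K z) x else 0)"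
    by (intro sum.cong) auto
  finally show ?thesis
    using fin by simp
qed

text \<open>One step of the Knothe rearrangement. Over each pair \<open>z = (a, b)\<close> drawn from
  \<open>\<pi>\<^sub>0\<close>, the conditional laws of \<open>\<mu>\<close> given \<open>S =
  a\<close> and of \<open>\<nu>\<close> given \<open>S = b\<close> are coupled monotonically. The
  last two conclusions express that \<open>x\<close> is conditionally independent of \<open>S
  y\<close> given \<open>S x\<close>, and symmetrically: the conditional law of \<open>x\<close>
  was chosen as a function of \<open>S x\<close> alone.\<close>

lemma knothe_gluing:
  fixes \<mu> \<nu> :: "'a pmf" and S :: "'a \<Rightarrow> 'b"
  assumes fin: "finite (set_pmf \<mu>)" "finite (set_pmf \<nu>)"
    and base: "is_coupling \<pi>\<^sub>0 (map_pmf S \<mu>) (map_pmf S \<nu>)"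
    and total: "\<And>x y. le x y \<or> le y x"
    and trans: "\<And>x y z. le x y \<Longrightarrow> le y z \<Longrightarrow> le x z"
  obtains \<pi> where "is_coupling \<pi> \<mu> \<nu>"
    and "map_pmf (\<lambda>(x, y). (S x, S y)) \<pi> = \<pi>\<^sub>0"
    and "\<And>x y x' y'. (x, y) \<in> set_pmf \<pi> \<Longrightarrow> (x', y') \<in> set_pmf \<pi> \<Longrightarrow> S x = S x' \<Longrightarrow> S y = S y' \<Longrightarrow>
      le x x' \<and> le y y' \<or> le x' x \<and> le y' y"
    and "\<And>x y. (x, y) \<in> set_pmf \<pi> \<Longrightarrow>
      pmf (map_pmf (\<lambda>(x, y). ((S x, S y), x)) \<pi>) ((S x, S y), x) * pmf (map_pmf S \<mu>) (S x) =
      pmf \<pi>\<^sub>0 (S x, S y) * pmf \<mu> x"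
    and "\<And>x y. (x, y) \<in> set_pmf \<pi> \<Longrightarrow>
      pmf (map_pmf (\<lambda>(x, y). ((S x, S y), y)) \<pi>) ((S x, S y), y) * pmf (map_pmf S \<nu>) (S y) =
      pmf \<pi>\<^sub>0 (S x, S y) * pmf \<nu> y"
proof -
  define M where "M a = cond_pmf \<mu> {x. S x = a}" for a
  define N where "N b = cond_pmf \<nu> {y. S y = b}" for b
  have fst_\<pi>\<^sub>0: "map_pmf fst \<pi>\<^sub>0 = map_pmf S \<mu>" and snd_\<pi>\<^sub>0: "map_pmf snd \<pi>\<^sub>0 = map_pmf S \<nu>"
    using base by (auto simp: is_coupling_def)
  have in_fst: "fst z \<in> S ` set_pmf \<mu>" and in_snd: "snd z \<in> S ` set_pmf \<nu>" if "z \<in> set_pmf \<pi>\<^sub>0" for z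
    using that fst_\<pi>\<^sub>0 snd_\<pi>\<^sub>0 by (metis imageI set_map_pmf)+
  have fin_\<pi>\<^sub>0: "finite (set_pmf \<pi>\<^sub>0)"
  proof (rule finite_subset)
    show "set_pmf \<pi>\<^sub>0 \<subseteq> S ` set_pmf \<mu> \<times> S ` set_pmf \<nu>"
      using in_fst in_snd by (auto simp: mem_Times_iff)
  qed (use fin in auto)
  have ne: "set_pmf \<mu> \<inter> {x. S x = fst z} \<noteq> {}" "set_pmf \<nu> \<inter> {y. S y = snd z} \<noteq> {}"
    if "z \<in> set_pmf \<pi>\<^sub>0" for z
    using in_fst[OF that] in_snd[OF that] by force+
  have set_M: "set_pmf (M (fst z)) = set_pmf \<mu> \<inter> {x. S x = fst z}"
    and set_N: "set_pmf (N (snd z)) = set_pmf \<nu> \<inter> {y. S y = snd z}" if "z \<in> set_pmf \<pi>\<^sub>0" for z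
    using ne[OF that] by (auto simp: M_def N_def)
  have "\<forall>z\<in>set_pmf \<pi>\<^sub>0. \<exists>\<kappa>. is_coupling \<kappa> (M (fst z)) (N (snd z)) \<and>
    (\<forall>x y x' y'. (x, y) \<in> set_pmf \<kappa> \<longrightarrow> (x', y') \<in> set_pmf \<kappa> \<longrightarrow>
      le x x' \<and> le y y' \<or> le x' x \<and> le y' y)"
  proof
    fix z assume "z \<in> set_pmf \<pi>\<^sub>0"
    then have fin_MN: "finite (set_pmf (M (fst z)))" "finite (set_pmf (N (snd z)))"
      using set_M set_N fin by auto
    show "\<exists>\<kappa>. is_coupling \<kappa> (M (fst z)) (N (snd z)) \<and>
      (\<forall>x y x' y'. (x, y) \<in> set_pmf \<kappa> \<longrightarrow> (x', y') \<in> set_pmf \<kappa> \<longrightarrow>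
        le x x' \<and> le y y' \<or> le x' x \<and> le y' y)"
      by (rule monotone_coupling; (rule fin_MN total | erule (1) trans))
  qed
  then obtain \<kappa> where \<kappa>: "\<forall>z\<in>set_pmf \<pi>\<^sub>0. is_coupling (\<kappa> z) (M (fst z)) (N (snd z)) \<and>
    (\<forall>x y x' y'. (x, y) \<in> set_pmf (\<kappa> z) \<longrightarrow> (x', y') \<in> set_pmf (\<kappa> z) \<longrightarrow>
      le x x' \<and> le y y' \<or> le x' x \<and> le y' y)"
    by (drule_tac bchoice) blast
  have \<kappa>_coupling: "is_coupling (\<kappa> z) (M (fst z)) (N (snd z))" if "z \<in> set_pmf \<pi>\<^sub>0" for z
    using \<kappa> that by simp
  have \<kappa>_mono: "le x x' \<and> le y y' \<or> le x' x \<and> le y' y"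
    if "z \<in> set_pmf \<pi>\<^sub>0" "(x, y) \<in> set_pmf (\<kappa> z)" "(x', y') \<in> set_pmf (\<kappa> z)" for z x y x' y'
    using \<kappa> that by blast
  have \<kappa>_fst: "map_pmf fst (\<kappa> z) = M (fst z)" and \<kappa>_snd: "map_pmf snd (\<kappa> z) = N (snd z)"
    if "z \<in> set_pmf \<pi>\<^sub>0" for z
    using \<kappa>_coupling[OF that] by (auto simp: is_coupling_def)
  have \<kappa>_supp: "(S x, S y) = z" if "z \<in> set_pmf \<pi>\<^sub>0" "(x, y) \<in> set_pmf (\<kappa> z)" for x y z
  proof -
    have "x \<in> set_pmf (M (fst z))" "y \<in> set_pmf (N (snd z))"
      using that(2) \<kappa>_fst[OF that(1), symmetric] \<kappa>_snd[OF that(1), symmetric] by force+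
    then show ?thesis using set_M[OF that(1)] set_N[OF that(1)] by (auto simp: prod_eq_iff)
  qed
  define \<pi> where "\<pi> = bind_pmf \<pi>\<^sub>0 \<kappa>"
  have "map_pmf fst \<pi> = bind_pmf \<pi>\<^sub>0 (\<lambda>z. M (fst z))"
    unfolding \<pi>_def map_bind_pmf by (intro bind_pmf_cong refl \<kappa>_fst)
  also have "\<dots> = bind_pmf (map_pmf S \<mu>) M"
    by (simp add: fst_\<pi>\<^sub>0[symmetric] bind_map_pmf)
  also have "\<dots> = \<mu>"
    unfolding M_def by (rule bind_cond_pmf_cancel) (auto simp: measure_map_pmf vimage_def intro!: arg_cong[of _ _ "measure \<mu>"])
  finally have fst_\<pi>: "map_pmf fst \<pi> = \<mu>" .
  have "map_pmf snd \<pi> = bind_pmf \<pi>\<^sub>0 (\<lambda>z. N (snd z))"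
    unfolding \<pi>_def map_bind_pmf by (intro bind_pmf_cong refl \<kappa>_snd)
  also have "\<dots> = bind_pmf (map_pmf S \<nu>) N"
    by (simp add: snd_\<pi>\<^sub>0[symmetric] bind_map_pmf)
  also have "\<dots> = \<nu>"
    unfolding N_def by (rule bind_cond_pmf_cancel) (auto simp: measure_map_pmf vimage_def intro!: arg_cong[of _ _ "measure \<nu>"])
  finally have snd_\<pi>: "map_pmf snd \<pi> = \<nu>" .
  have map_\<kappa>: "map_pmf (\<lambda>(x, y). ((S x, S y), f (x, y))) (\<kappa> z) = map_pmf (Pair z) (map_pmf f (\<kappa> z))"
    if "z \<in> set_pmf \<pi>\<^sub>0" for z and f :: "'a \<times> 'a \<Rightarrow> 'a"
    unfolding map_pmf_comp using \<kappa>_supp[OF that] by (intro map_pmf_cong) auto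
  have "map_pmf (\<lambda>(x, y). (S x, S y)) \<pi> = bind_pmf \<pi>\<^sub>0 (\<lambda>z. map_pmf (\<lambda>_. z) (\<kappa> z))"
    unfolding \<pi>_def map_bind_pmf using \<kappa>_supp by (intro bind_pmf_cong map_pmf_cong) auto
  then have base_\<pi>: "map_pmf (\<lambda>(x, y). (S x, S y)) \<pi> = \<pi>\<^sub>0"
    by (simp add: bind_return_pmf')
  have in_\<pi>\<^sub>0: "(S x, S y) \<in> set_pmf \<pi>\<^sub>0" if "(x, y) \<in> set_pmf \<pi>" for x y
    using that unfolding base_\<pi>[symmetric] by force
  have in_\<kappa>: "(x, y) \<in> set_pmf (\<kappa> (S x, S y))" if "(x, y) \<in> set_pmf \<pi>" for x y
    using that \<kappa>_supp by (auto simp: \<pi>_def)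
  show thesis
  proof (rule that)
    show "is_coupling \<pi> \<mu> \<nu>"
      using fst_\<pi> snd_\<pi> by (simp add: is_coupling_def)
    show "map_pmf (\<lambda>(x, y). (S x, S y)) \<pi> = \<pi>\<^sub>0"
      by (fact base_\<pi>)
    show "le x x' \<and> le y y' \<or> le x' x \<and> le y' y"
      if "(x, y) \<in> set_pmf \<pi>" "(x', y') \<in> set_pmf \<pi>" "S x = S x'" "S y = S y'" for x y x' y'
      using \<kappa>_mono[of "(S x, S y)" x y x' y'] in_\<pi>\<^sub>0[of x y] in_\<kappa>[of x y] in_\<kappa>[of x' y'] that by simp
    fix x y assume xy: "(x, y) \<in> set_pmf \<pi>"
    have x: "x \<in> set_pmf \<mu>" and y: "y \<in> set_pmf \<nu>"
      using xy unfolding fst_\<pi>[symmetric] snd_\<pi>[symmetric] by force+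
    have "map_pmf (\<lambda>(x, y). ((S x, S y), x)) \<pi> = bind_pmf \<pi>\<^sub>0 (\<lambda>z. map_pmf (Pair z) (M (fst z)))"
      unfolding \<pi>_def map_bind_pmf
      using map_\<kappa>[of _ fst] by (intro bind_pmf_cong refl) (simp add: \<kappa>_fst)
    then have "pmf (map_pmf (\<lambda>(x, y). ((S x, S y), x)) \<pi>) ((S x, S y), x) = pmf \<pi>\<^sub>0 (S x, S y) * pmf (M (S x)) x"
      by (simp add: pmf_map_bind_dependent_pair[OF fin_\<pi>\<^sub>0])
    moreover have "pmf (M (S x)) x * pmf (map_pmf S \<mu>) (S x) = pmf \<mu> x"
    proof -
      have "pmf (map_pmf S \<mu>) (S x) = measure \<mu> {x'. S x' = S x}"
        by (simp add: pmf_map vimage_def)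
      moreover have "set_pmf \<mu> \<inter> {x'. S x' = S x} \<noteq> {}" using x by blast
      moreover have "0 < pmf (map_pmf S \<mu>) (S x)" by (rule pmf_map_pos[OF x])
      ultimately show ?thesis by (simp add: M_def pmf_cond)
    qed
    ultimately show "pmf (map_pmf (\<lambda>(x, y). ((S x, S y), x)) \<pi>) ((S x, S y), x) * pmf (map_pmf S \<mu>) (S x) =
      pmf \<pi>\<^sub>0 (S x, S y) * pmf \<mu> x" by simp
    have "map_pmf (\<lambda>(x, y). ((S x, S y), y)) \<pi> = bind_pmf \<pi>\<^sub>0 (\<lambda>z. map_pmf (Pair z) (N (snd z)))"
      unfolding \<pi>_def map_bind_pmf
      using map_\<kappa>[of _ snd] by (intro bind_pmf_cong refl) (simp add: \<kappa>_snd)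
    then have "pmf (map_pmf (\<lambda>(x, y). ((S x, S y), y)) \<pi>) ((S x, S y), y) = pmf \<pi>\<^sub>0 (S x, S y) * pmf (N (S y)) y"
      by (simp add: pmf_map_bind_dependent_pair[OF fin_\<pi>\<^sub>0])
    moreover have "pmf (N (S y)) y * pmf (map_pmf S \<nu>) (S y) = pmf \<nu> y"
    proof -
      have "pmf (map_pmf S \<nu>) (S y) = measure \<nu> {y'. S y' = S y}"
        by (simp add: pmf_map vimage_def)
      moreover have "set_pmf \<nu> \<inter> {y'. S y' = S y} \<noteq> {}" using y by blast
      moreover have "0 < pmf (map_pmf S \<nu>) (S y)" by (rule pmf_map_pos[OF y])
      ultimately show ?thesis by (simp add: N_def pmf_cond)
    qed
    ultimately show "pmf (map_pmf (\<lambda>(x, y). ((S x, S y), y)) \<pi>) ((S x, S y), y) * pmf (map_pmf S \<nu>) (S y) =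
      pmf \<pi>\<^sub>0 (S x, S y) * pmf \<nu> y" by simp
  qed
qed

section \<open>The entropy inequality on a chain\<close>

text \<open>If two points of a fibre of \<open>D\<close> always share \<open>X\<close> or share
  \<open>Y\<close>, then one of the two variables is constant on the whole fibre: a point that
  differs from \<open>\<omega>\<close> in \<open>X\<close> and a point that differs from
  \<open>\<omega>\<close> in \<open>Y\<close> would differ from each other in both. Hence
  \<open>X\<close> and \<open>Y\<close> are conditionally independent given \<open>D\<close>.\<close>

lemma counting_entropy_split_fibres:
  assumes fin: "finite (set_pmf p)"
    and share: "\<And>\<omega> \<omega>'. \<omega> \<in> set_pmf p \<Longrightarrow> \<omega>' \<in> set_pmf p \<Longrightarrow> D \<omega> = D \<omega>' \<Longrightarrow> X \<omega> = X \<omega>' \<or> Y \<omega> = Y \<omega>'"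
  shows "counting_entropy (map_pmf D p) + counting_entropy (map_pmf (\<lambda>\<omega>. (D \<omega>, X \<omega>, Y \<omega>)) p) =
    counting_entropy (map_pmf (\<lambda>\<omega>. (D \<omega>, X \<omega>)) p) + counting_entropy (map_pmf (\<lambda>\<omega>. (D \<omega>, Y \<omega>)) p)"
proof (rule counting_entropy_modular[OF fin])
  fix \<omega> assume \<omega>: "\<omega> \<in> set_pmf p"
  consider (X) "\<forall>\<omega>'\<in>set_pmf p. D \<omega>' = D \<omega> \<longrightarrow> X \<omega>' = X \<omega>"
    | (Y) "\<forall>\<omega>'\<in>set_pmf p. D \<omega>' = D \<omega> \<longrightarrow> Y \<omega>' = Y \<omega>"
  proof (rule ccontr)
    assume "\<not> thesis"
    with that obtain \<omega>\<^sub>1 \<omega>\<^sub>2 where 1: "\<omega>\<^sub>1 \<in> set_pmf p" "D \<omega>\<^sub>1 = D \<omega>" "X \<omega>\<^sub>1 \<noteq> X \<omega>"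
      and 2: "\<omega>\<^sub>2 \<in> set_pmf p" "D \<omega>\<^sub>2 = D \<omega>" "Y \<omega>\<^sub>2 \<noteq> Y \<omega>"
      by blast
    then have "Y \<omega>\<^sub>1 = Y \<omega>" "X \<omega>\<^sub>2 = X \<omega>"
      using share \<omega> by blast+
    then show False using share[OF 1(1) 2(1)] 1 2 by simp
  qed
  then show "pmf (map_pmf D p) (D \<omega>) * pmf (map_pmf (\<lambda>\<omega>. (D \<omega>, X \<omega>, Y \<omega>)) p) (D \<omega>, X \<omega>, Y \<omega>) =
    pmf (map_pmf (\<lambda>\<omega>. (D \<omega>, X \<omega>)) p) (D \<omega>, X \<omega>) * pmf (map_pmf (\<lambda>\<omega>. (D \<omega>, Y \<omega>)) p) (D \<omega>, Y \<omega>)"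
  proof cases
    case X
    have "pmf (map_pmf D p) (D \<omega>) = pmf (map_pmf (\<lambda>\<omega>. (D \<omega>, X \<omega>)) p) (D \<omega>, X \<omega>)"
      by (rule pmf_map_fibre_cong[OF fin, where f = D and g = "\<lambda>\<omega>. (D \<omega>, X \<omega>)"]) (use X in auto)
    moreover have "pmf (map_pmf (\<lambda>\<omega>. (D \<omega>, X \<omega>, Y \<omega>)) p) (D \<omega>, X \<omega>, Y \<omega>) =
        pmf (map_pmf (\<lambda>\<omega>. (D \<omega>, Y \<omega>)) p) (D \<omega>, Y \<omega>)"
      by (rule pmf_map_fibre_cong[OF fin, where f = "\<lambda>\<omega>. (D \<omega>, X \<omega>, Y \<omega>)" and g = "\<lambda>\<omega>. (D \<omega>, Y \<omega>)"])
        (use X in auto)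
    ultimately show ?thesis by simp
  next
    case Y
    have "pmf (map_pmf D p) (D \<omega>) = pmf (map_pmf (\<lambda>\<omega>. (D \<omega>, Y \<omega>)) p) (D \<omega>, Y \<omega>)"
      by (rule pmf_map_fibre_cong[OF fin, where f = D and g = "\<lambda>\<omega>. (D \<omega>, Y \<omega>)"]) (use Y in auto)
    moreover have "pmf (map_pmf (\<lambda>\<omega>. (D \<omega>, X \<omega>, Y \<omega>)) p) (D \<omega>, X \<omega>, Y \<omega>) =
        pmf (map_pmf (\<lambda>\<omega>. (D \<omega>, X \<omega>)) p) (D \<omega>, X \<omega>)"
      by (rule pmf_map_fibre_cong[OF fin, where f = "\<lambda>\<omega>. (D \<omega>, X \<omega>, Y \<omega>)" and g = "\<lambda>\<omega>. (D \<omega>, X \<omega>)"])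
        (use Y in auto)
    ultimately show ?thesis by simp
  qed
qed

text \<open>The core inequality, conditionally on \<open>C\<close>. The fibre property turns
  \<open>M\<close> into the pairs \<open>(M, X)\<close> and \<open>(M, Y)\<close>, and likewise
  \<open>P\<close>. Supermodularity then merges \<open>(M, X)\<close> with \<open>(P, X)\<close>:
  jointly they determine \<open>(X, Y)\<close>, since \<open>X\<close> and \<open>Y\<close>
  determine each other once \<open>M\<close> and \<open>P\<close> are known. All copies of the
  entropy of \<open>(X, Y)\<close> cancel.\<close>

lemma counting_entropy_exchange:
  assumes fin: "finite (set_pmf p)"
    and share_M: "\<And>\<omega> \<omega>'. \<omega> \<in> set_pmf p \<Longrightarrow> \<omega>' \<in> set_pmf p \<Longrightarrow> C \<omega> = C \<omega>' \<Longrightarrow> M \<omega> = M \<omega>' \<Longrightarrow>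
      X \<omega> = X \<omega>' \<or> Y \<omega> = Y \<omega>'"
    and share_P: "\<And>\<omega> \<omega>'. \<omega> \<in> set_pmf p \<Longrightarrow> \<omega>' \<in> set_pmf p \<Longrightarrow> C \<omega> = C \<omega>' \<Longrightarrow> P \<omega> = P \<omega>' \<Longrightarrow>
      X \<omega> = X \<omega>' \<or> Y \<omega> = Y \<omega>'"
    and XY: "\<And>\<omega> \<omega>'. \<omega> \<in> set_pmf p \<Longrightarrow> \<omega>' \<in> set_pmf p \<Longrightarrow> X \<omega> = X \<omega>' \<Longrightarrow> Y \<omega> = Y \<omega>' \<Longrightarrow>
      C \<omega> = C \<omega>' \<and> M \<omega> = M \<omega>' \<and> P \<omega> = P \<omega>'"
    and MP: "\<And>\<omega> \<omega>'. \<omega> \<in> set_pmf p \<Longrightarrow> \<omega>' \<in> set_pmf p \<Longrightarrow> M \<omega> = M \<omega>' \<Longrightarrow> P \<omega> = P \<omega>' \<Longrightarrow>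
      X \<omega> = X \<omega>' \<longleftrightarrow> Y \<omega> = Y \<omega>'"
  shows "counting_entropy (map_pmf (\<lambda>\<omega>. (C \<omega>, M \<omega>)) p) + counting_entropy (map_pmf (\<lambda>\<omega>. (C \<omega>, P \<omega>)) p) \<le>
    counting_entropy (map_pmf (\<lambda>\<omega>. (C \<omega>, X \<omega>)) p) + counting_entropy (map_pmf (\<lambda>\<omega>. (C \<omega>, Y \<omega>)) p)"
proof -
  let ?h = "\<lambda>f. counting_entropy (map_pmf f p)"
  let ?XY = "\<lambda>\<omega>. (X \<omega>, Y \<omega>)"
  \<comment> \<open>\<open>?h\<close> is \<open>\<Sum> p ln p\<close>, the negative of Shannon entropy, so supermodularity bounds it from above.\<close>
  have M: "?h (\<lambda>\<omega>. (C \<omega>, M \<omega>)) + ?h (\<lambda>\<omega>. ((C \<omega>, M \<omega>), X \<omega>, Y \<omega>)) =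
      ?h (\<lambda>\<omega>. ((C \<omega>, M \<omega>), X \<omega>)) + ?h (\<lambda>\<omega>. ((C \<omega>, M \<omega>), Y \<omega>))"
    by (rule counting_entropy_split_fibres[OF fin]) (use share_M in blast)
  have P: "?h (\<lambda>\<omega>. (C \<omega>, P \<omega>)) + ?h (\<lambda>\<omega>. ((C \<omega>, P \<omega>), X \<omega>, Y \<omega>)) =
      ?h (\<lambda>\<omega>. ((C \<omega>, P \<omega>), X \<omega>)) + ?h (\<lambda>\<omega>. ((C \<omega>, P \<omega>), Y \<omega>))"
    by (rule counting_entropy_split_fibres[OF fin]) (use share_P in blast)
  have "?h (\<lambda>\<omega>. ((C \<omega>, M \<omega>), X \<omega>, Y \<omega>)) = ?h ?XY" "?h (\<lambda>\<omega>. ((C \<omega>, P \<omega>), X \<omega>, Y \<omega>)) = ?h ?XY"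
    by (rule counting_entropy_cong[OF fin]; use XY in blast)+
  moreover have "?h (\<lambda>\<omega>. ((C \<omega>, M \<omega>), X \<omega>)) + ?h (\<lambda>\<omega>. ((C \<omega>, P \<omega>), X \<omega>)) \<le> ?h ?XY + ?h (\<lambda>\<omega>. (C \<omega>, X \<omega>))"
    by (rule counting_entropy_supermodular[OF fin]; use XY MP in blast)
  moreover have "?h (\<lambda>\<omega>. ((C \<omega>, M \<omega>), Y \<omega>)) + ?h (\<lambda>\<omega>. ((C \<omega>, P \<omega>), Y \<omega>)) \<le> ?h ?XY + ?h (\<lambda>\<omega>. (C \<omega>, Y \<omega>))"
    by (rule counting_entropy_supermodular[OF fin]; use XY MP in blast)
  ultimately show ?thesis using M P by linarith
qed

section \<open>Direct sums and Knothe monotone operations\<close>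

locale direct_sum =
  fixes k :: nat and G :: "nat \<Rightarrow> 'a::ab_group_add set"
  assumes decomposition: "direct_sum_decomposition k G"
begin

abbreviation part :: "nat \<Rightarrow> 'a \<Rightarrow> 'a" where
  "part \<equiv> component k G"

text \<open>The projection onto \<open>G 1 \<times> \<dots> \<times> G i\<close>, kept inside the ambient
  group so that the induction over \<open>i\<close> takes place on a single type.\<close>

definition truncate :: "nat \<Rightarrow> 'a \<Rightarrow> 'a" where
  "truncate i x = (\<Sum>j=1..i. part j x)"

lemma subgroup: "i \<in> {1..k} \<Longrightarrow> additive_subgroup (G i)"
  using decomposition by (simp add: direct_sum_decomposition_def)

lemma zero_in [simp]: "i \<in> {1..k} \<Longrightarrow> 0 \<in> G i"
  and add_in: "i \<in> {1..k} \<Longrightarrow> u \<in> G i \<Longrightarrow> v \<in> G i \<Longrightarrow> u + v \<in> G i"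
  and diff_in: "i \<in> {1..k} \<Longrightarrow> u \<in> G i \<Longrightarrow> v \<in> G i \<Longrightarrow> u - v \<in> G i"
  using subgroup[of i] unfolding additive_subgroup_def
  by (blast, blast, metis diff_conv_add_uminus)

lemma unique_components: "\<exists>!g. g \<in> Pi\<^sub>E {1..k} G \<and> x = (\<Sum>i=1..k. g i)"
  using decomposition by (simp add: direct_sum_decomposition_def)

lemma part_eqI:
  assumes "\<And>j. j \<in> {1..k} \<Longrightarrow> g j \<in> G j" and "x = (\<Sum>j=1..k. g j)" and "i \<in> {1..k}"
  shows "part i x = g i"
proof -
  have "restrict g {1..k} \<in> Pi\<^sub>E {1..k} G \<and> x = (\<Sum>j=1..k. restrict g {1..k} j)"
    using assms by auto
  then have "(THE g. g \<in> Pi\<^sub>E {1..k} G \<and> x = (\<Sum>j=1..k. g j)) = restrict g {1..k}"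
    using unique_components[of x] by (intro the1_equality)
  then show ?thesis
    using assms(3) by (simp add: component_def)
qed

lemma part_in: "i \<in> {1..k} \<Longrightarrow> part i x \<in> G i"
  and sum_part: "(\<Sum>j=1..k. part j x) = x"
  using theI'[OF unique_components[of x]] by (auto simp: component_def)

lemma part_add: "i \<in> {1..k} \<Longrightarrow> part i (x + y) = part i x + part i y"
  by (rule part_eqI[where g = "\<lambda>j. part j x + part j y"])
    (simp_all only: part_in add_in sum.distrib sum_part)

lemma part_of_summand:
  assumes "i \<in> {1..k}" "j \<in> {1..k}" "u \<in> G i"
  shows "part j u = (if j = i then u else 0)"
  by (rule part_eqI[where g = "\<lambda>j. if j = i then u else 0"]) (use assms in auto)

lemma part_truncate:
  assumes "i \<le> k" "j \<in> {1..k}"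
  shows "part j (truncate i x) = (if j \<le> i then part j x else 0)"
proof (rule part_eqI[where g = "\<lambda>j. if j \<le> i then part j x else 0"])
  show "truncate i x = (\<Sum>j=1..k. if j \<le> i then part j x else 0)"
    unfolding truncate_def using assms by (intro sum.mono_neutral_cong_left) auto
qed (use assms part_in in auto)

lemma truncate_0 [simp]: "truncate 0 x = 0"
  and truncate_Suc: "truncate (Suc i) x = truncate i x + part (Suc i) x"
  and truncate_all: "truncate k x = x"
  using sum_part[of x] by (simp_all add: truncate_def)

lemma truncate_add: "i \<le> k \<Longrightarrow> truncate i (x + y) = truncate i x + truncate i y"
  by (simp add: truncate_def part_add sum.distrib)

lemma truncate_eq_iff:
  assumes "i \<le> k"
  shows "truncate i x = truncate i y \<longleftrightarrow> (\<forall>j\<in>{1..i}. part j x = part j y)"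
proof
  assume eq: "truncate i x = truncate i y"
  show "\<forall>j\<in>{1..i}. part j x = part j y"
  proof
    fix j assume "j \<in> {1..i}"
    then show "part j x = part j y"
      using part_truncate[OF assms, of j x] part_truncate[OF assms, of j y] eq assms by simp
  qed
qed (simp add: truncate_def)

lemma truncate_truncate:
  assumes "i \<le> j" "j \<le> k"
  shows "truncate i (truncate j x) = truncate i x"
  using assms by (subst truncate_eq_iff) (auto simp: part_truncate)

lemma truncate_add_later:
  assumes "Suc i \<le> k" "u \<in> G (Suc i)"
  shows "truncate i (x + u) = truncate i x"
proof -
  have "part j u = 0" if "j \<in> {1..i}" for j
    using part_of_summand[of "Suc i" j u] that assms by auto
  then show ?thesis
    using assms by (simp add: truncate_add) (simp add: truncate_def)
qed

lemma truncate_in_partial_sums: "i \<le> k \<Longrightarrow> truncate i x \<in> partial_sums_below G (Suc i)"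
  unfolding truncate_def partial_sums_below_def
  by (rule image_eqI[of _ _ "\<lambda>j. part j x"]) (auto simp: atLeastLessThanSuc_atLeastAtMost part_in)

text \<open>Monotonicity of the component \<open>Suc i\<close> of \<open>T\<close> between arbitrary
  elements with equal truncations. Not insisting on arguments of the form \<open>a + x\<close>
  with \<open>x\<close> in the summand makes translations by elements of the summand directly
  available.\<close>

definition level_monotone :: "nat \<Rightarrow> ('a \<times> 'a) set \<Rightarrow> ('a \<Rightarrow> 'a \<Rightarrow> 'a) \<Rightarrow> bool" where
  "level_monotone i r T \<longleftrightarrow> (\<forall>x x' y y'. truncate i x = truncate i x' \<longrightarrow> truncate i y = truncate i y' \<longrightarrow>
     (part (Suc i) x, part (Suc i) x') \<in> r \<longrightarrow> (part (Suc i) y, part (Suc i) y') \<in> r \<longrightarrow>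
     (part (Suc i) (T x y), part (Suc i) (T x' y')) \<in> r)"

lemma level_monotoneD:
  "level_monotone i r T \<Longrightarrow> truncate i x = truncate i x' \<Longrightarrow> truncate i y = truncate i y' \<Longrightarrow>
     (part (Suc i) x, part (Suc i) x') \<in> r \<Longrightarrow> (part (Suc i) y, part (Suc i) y') \<in> r \<Longrightarrow>
     (part (Suc i) (T x y), part (Suc i) (T x' y')) \<in> r"
  unfolding level_monotone_def by blast

lemma part_diff: "i \<in> {1..k} \<Longrightarrow> part i (x - y) = part i x - part i y"
  using part_add[of i "x - y" y] by (simp add: algebra_simps)

end

locale ordered_level = direct_sum k G for k and G :: "nat \<Rightarrow> 'a::ab_group_add set" +
  fixes i :: nat and r :: "('a \<times> 'a) set"
  assumes level: "Suc i \<le> k" and ordering: "total_additive_ordering (G (Suc i)) r"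
begin

abbreviation coord :: "'a \<Rightarrow> 'a" where "coord \<equiv> part (Suc i)"

lemma c_in: "coord x \<in> G (Suc i)"
  using level by (intro part_in) simp

lemma c_add: "coord (x + y) = coord x + coord y"
  using level by (intro part_add) simp

lemma c_diff: "coord (x - y) = coord x - coord y"
  using level by (intro part_diff) simp

lemma c_self: "u \<in> G (Suc i) \<Longrightarrow> coord u = u"
  using level part_of_summand[of "Suc i" "Suc i" u] by simp

lemma linear_order: "linear_order_on (G (Suc i)) r"
  using ordering by (simp add: total_additive_ordering_def)

lemma le_refl: "u \<in> G (Suc i) \<Longrightarrow> (u, u) \<in> r"
  and le_trans: "(u, v) \<in> r \<Longrightarrow> (v, w) \<in> r \<Longrightarrow> (u, w) \<in> r"
  and le_antisym: "(u, v) \<in> r \<Longrightarrow> (v, u) \<in> r \<Longrightarrow> u = v"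
  using linear_order unfolding order_on_defs
  by (auto dest: refl_onD transD antisymD)

lemma le_total: "u \<in> G (Suc i) \<Longrightarrow> v \<in> G (Suc i) \<Longrightarrow> (u, v) \<in> r \<or> (v, u) \<in> r"
  using linear_order le_refl unfolding linear_order_on_def total_on_def by metis

lemma le_add:
  "u \<in> G (Suc i) \<Longrightarrow> v \<in> G (Suc i) \<Longrightarrow> w \<in> G (Suc i) \<Longrightarrow> (u, v) \<in> r \<Longrightarrow> (u + w, v + w) \<in> r"
  using ordering by (simp add: total_additive_ordering_def)

lemma uminus_in: "u \<in> G (Suc i) \<Longrightarrow> - u \<in> G (Suc i)"
  using level diff_in[of "Suc i" 0 u] by simp

lemma G_add: "u \<in> G (Suc i) \<Longrightarrow> v \<in> G (Suc i) \<Longrightarrow> u + v \<in> G (Suc i)"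
  and G_diff: "u \<in> G (Suc i) \<Longrightarrow> v \<in> G (Suc i) \<Longrightarrow> u - v \<in> G (Suc i)"
  using level by (auto intro: add_in diff_in)

lemma le_iff_diff:
  assumes "u \<in> G (Suc i)" "v \<in> G (Suc i)"
  shows "(u, v) \<in> r \<longleftrightarrow> (0, v - u) \<in> r"
proof
  assume "(u, v) \<in> r"
  then show "(0, v - u) \<in> r"
    using le_add[of u v "- u"] uminus_in assms by simp
next
  assume "(0, v - u) \<in> r"
  moreover have "0 \<in> G (Suc i)" using level by simp
  ultimately show "(u, v) \<in> r"
    using le_add[of 0 "v - u" u] G_diff assms by simp
qed

text \<open>Why one decomposition serves both operations. If the coordinates of the arguments grow by
  \<open>\<alpha>, \<beta> \<ge> 0\<close>, then both stay below a common translation by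
  \<open>\<alpha> + \<beta>\<close>, so \<open>T\<close> grows by at most \<open>\<alpha> +
  \<beta>\<close>. This is exactly the growth of \<open>x + y\<close>, which leaves a nonnegative
  growth for \<open>T'\<close>.\<close>

lemma level_monotone_complement:
  assumes T: "level_monotone i r T" "translation_equivariant T"
    and compl: "complementing T T'"
  shows "level_monotone i r T'"
  unfolding level_monotone_def
proof (intro allI impI)
  fix x x' y y'
  assume trunc: "truncate i x = truncate i x'" "truncate i y = truncate i y'"
    and le: "(coord x, coord x') \<in> r" "(coord y, coord y') \<in> r"
  define \<alpha> \<beta> where "\<alpha> = coord x' - coord x" and "\<beta> = coord y' - coord y"
  have in_G: "\<alpha> \<in> G (Suc i)" "\<beta> \<in> G (Suc i)" "\<alpha> + \<beta> \<in> G (Suc i)"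
    unfolding \<alpha>_def \<beta>_def by (intro G_add G_diff c_in)+
  have pos: "(0, \<alpha>) \<in> r" "(0, \<beta>) \<in> r"
    using le le_iff_diff[OF c_in c_in, of x x'] le_iff_diff[OF c_in c_in, of y y']
    by (simp_all add: \<alpha>_def \<beta>_def)
  have T'_eq: "T' u v = u + v - T u v" for u v
    using compl by (simp add: complementing_def algebra_simps)
  have "(coord (T x' y'), coord (T (x + (\<alpha> + \<beta>)) (y + (\<alpha> + \<beta>)))) \<in> r"
  proof (rule level_monotoneD[OF T(1)])
    show "truncate i x' = truncate i (x + (\<alpha> + \<beta>))" "truncate i y' = truncate i (y + (\<alpha> + \<beta>))"
      using trunc truncate_add_later[OF level in_G(3)] by simp_all
    have "coord (x + (\<alpha> + \<beta>)) - coord x' = \<beta>" "coord (y + (\<alpha> + \<beta>)) - coord y' = \<alpha>"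
      by (simp_all only: c_add[of x] c_add[of y] c_self[OF in_G(3)]) (simp_all add: \<alpha>_def \<beta>_def)
    then show "(coord x', coord (x + (\<alpha> + \<beta>))) \<in> r" "(coord y', coord (y + (\<alpha> + \<beta>))) \<in> r"
      using pos by (simp_all only: le_iff_diff[OF c_in c_in])
  qed
  then have "(coord (T x' y'), coord (T x y) + (\<alpha> + \<beta>)) \<in> r"
    using T(2) in_G by (simp add: translation_equivariant_def c_add c_self)
  then have "(0, coord (T x y) + (\<alpha> + \<beta>) - coord (T x' y')) \<in> r"
    using in_G le_iff_diff[of "coord (T x' y')" "coord (T x y) + (\<alpha> + \<beta>)"] by (simp add: c_in G_add)
  also have "coord (T x y) + (\<alpha> + \<beta>) - coord (T x' y') = coord (T' x' y') - coord (T' x y)"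
    by (simp add: T'_eq c_add c_diff \<alpha>_def \<beta>_def)
  finally show "(coord (T' x y), coord (T' x' y')) \<in> r"
    by (simp only: le_iff_diff[OF c_in c_in])
qed

lemma strict_level_increase_by:
  assumes T: "level_monotone i r T" "translation_equivariant T"
    and trunc: "truncate i x = truncate i x'" "truncate i y = truncate i y'"
    and \<delta>: "\<delta> \<in> G (Suc i)" "(0, \<delta>) \<in> r" "\<delta> \<noteq> 0"
    and step: "(coord x + \<delta>, coord x') \<in> r" "(coord y + \<delta>, coord y') \<in> r"
  shows "coord (T x y) \<noteq> coord (T x' y')"
proof
  assume eq: "coord (T x y) = coord (T x' y')"
  have "coord (x + \<delta>) = coord x + \<delta>" "coord (y + \<delta>) = coord y + \<delta>"
    using \<delta> by (simp_all add: c_add c_self)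
  then have "(coord (T (x + \<delta>) (y + \<delta>)), coord (T x' y')) \<in> r"
    using trunc step truncate_add_later[OF level \<delta>(1)] by (intro level_monotoneD[OF T(1)]) simp_all
  then have "(coord (T x y) + \<delta>, coord (T x y)) \<in> r"
    using T(2) \<delta> eq by (simp add: translation_equivariant_def c_add c_self)
  moreover have "(coord (T x y), coord (T x y) + \<delta>) \<in> r"
    using \<delta> le_iff_diff[of "coord (T x y)" "coord (T x y) + \<delta>"] by (simp add: c_in G_add)
  ultimately have "coord (T x y) + \<delta> = coord (T x y)"
    by (rule le_antisym)
  then show False using \<delta> by simp
qed

text \<open>The use of translation equivariance: if both coordinates strictly increase, then both do so by
  at least the smaller increment \<open>\<delta> > 0\<close>, and a translation by
  \<open>\<delta>\<close> already moves the value of \<open>T\<close> by \<open>\<delta>\<close>.\<close>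

lemma strict_level_increase:
  assumes T: "level_monotone i r T" "translation_equivariant T"
    and trunc: "truncate i x = truncate i x'" "truncate i y = truncate i y'"
    and le: "(coord x, coord x') \<in> r" "(coord y, coord y') \<in> r"
    and ne: "coord x \<noteq> coord x'" "coord y \<noteq> coord y'"
  shows "coord (T x y) \<noteq> coord (T x' y')"
proof -
  define \<alpha> \<beta> where "\<alpha> = coord x' - coord x" and "\<beta> = coord y' - coord y"
  have in_G: "\<alpha> \<in> G (Suc i)" "\<beta> \<in> G (Suc i)"
    unfolding \<alpha>_def \<beta>_def by (intro G_diff c_in)+
  have pos: "(0, \<alpha>) \<in> r" "(0, \<beta>) \<in> r"
    using le le_iff_diff[OF c_in c_in, of x x'] le_iff_diff[OF c_in c_in, of y y']
    by (simp_all add: \<alpha>_def \<beta>_def)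
  have coord': "coord x' = coord x + \<alpha>" "coord y' = coord y + \<beta>"
    by (simp_all add: \<alpha>_def \<beta>_def)
  have shift: "(u + v, u + w) \<in> r" if "(v, w) \<in> r" "u \<in> G (Suc i)" "v \<in> G (Suc i)" "w \<in> G (Suc i)" for u v w
    using le_add[of v w u] that by (simp add: add.commute)
  show ?thesis
  proof (cases "(\<alpha>, \<beta>) \<in> r")
    case True
    show ?thesis
      by (rule strict_level_increase_by[OF T trunc in_G(1) pos(1)])
        (use True ne in_G in \<open>auto simp: coord' intro: shift le_refl c_in G_add\<close>)
  next
    case False
    then have "(\<beta>, \<alpha>) \<in> r" using le_total in_G by blast
    then show ?thesis
      by (intro strict_level_increase_by[OF T trunc in_G(2) pos(2)])
        (use ne in_G in \<open>auto simp: coord' intro: shift le_refl c_in G_add\<close>)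
  qed
qed

end

context direct_sum
begin

text \<open>The first clause of Knothe monotonicity for all levels at once.\<close>

definition triangular :: "('a \<Rightarrow> 'a \<Rightarrow> 'a) \<Rightarrow> bool" where
  "triangular T \<longleftrightarrow> (\<forall>i\<le>k. \<forall>x y. truncate i (T (truncate i x) (truncate i y)) = truncate i (T x y))"

lemma triangularD:
  "triangular T \<Longrightarrow> i \<le> k \<Longrightarrow> truncate i (T (truncate i x) (truncate i y)) = truncate i (T x y)"
  by (simp add: triangular_def)

lemma triangular_complement:
  assumes "triangular T" and "complementing T T'"
  shows "triangular T'"
  unfolding triangular_def
proof (intro allI impI)
  fix i x y assume i: "i \<le> k"
  have T'_eq: "truncate i (T' u v) = truncate i u + truncate i v - truncate i (T u v)" for u v
  proof -
    have "truncate i (T u v) + truncate i (T' u v) = truncate i u + truncate i v"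
      using assms(2) i by (simp add: complementing_def truncate_add[symmetric])
    then show ?thesis by (simp add: algebra_simps)
  qed
  show "truncate i (T' (truncate i x) (truncate i y)) = truncate i (T' x y)"
    using i assms(1) by (simp add: T'_eq truncate_truncate triangularD)
qed

lemma truncate_SucD:
  "Suc i \<le> k \<Longrightarrow> truncate (Suc i) x = truncate (Suc i) y \<Longrightarrow> truncate i x = truncate i y"
  by (metis Suc_leD le_SucI order_refl truncate_truncate)

end

lemma knothe_monotone_level:
  assumes "knothe_monotone T"
  obtains k G where "direct_sum k G" and "direct_sum.triangular k G T"
    and "\<And>i. Suc i \<le> k \<Longrightarrow> \<exists>r. total_additive_ordering (G (Suc i)) r \<and> direct_sum.level_monotone k G i r T"
proof -
  obtain k G where dec: "direct_sum_decomposition k G"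
    and levels: "\<forall>i\<in>{1..k}.
         (\<forall>x x' y y'.
            (\<forall>j\<in>{1..i}. component k G j x = component k G j x' \<and>
                        component k G j y = component k G j y') \<longrightarrow>
            component k G i (T x y) = component k G i (T x' y')) \<and>
         (\<exists>r. total_additive_ordering (G i) r \<and>
            (\<forall>a\<in>partial_sums_below G i. \<forall>b\<in>partial_sums_below G i.
               \<forall>x1\<in>G i. \<forall>x2\<in>G i. \<forall>y1\<in>G i. \<forall>y2\<in>G i.
                 (x1, x2) \<in> r \<longrightarrow> (y1, y2) \<in> r \<longrightarrow>
                 (component k G i (T (a + x1) (b + y1)),
                  component k G i (T (a + x2) (b + y2))) \<in> r))"
    using assms unfolding knothe_monotone_def by (elim exE conjE) (rule that)
  have dep: "component k G i (T x y) = component k G i (T x' y')"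
    if "i \<in> {1..k}" and "\<forall>j\<in>{1..i}. component k G j x = component k G j x' \<and>
                        component k G j y = component k G j y'" for i x x' y y'
    using levels[rule_format, OF that(1), THEN conjunct1] that(2) by blast
  interpret direct_sum k G by unfold_locales (rule dec)
  show thesis
  proof (rule that)
    show "direct_sum k G" by unfold_locales
    show "triangular T"
      unfolding triangular_def
    proof (intro allI impI)
      fix i x y assume i: "i \<le> k"
      show "truncate i (T (truncate i x) (truncate i y)) = truncate i (T x y)"
        unfolding truncate_eq_iff[OF i]
      proof
        fix j assume "j \<in> {1..i}"
        then show "part j (T (truncate i x) (truncate i y)) = part j (T x y)"
          using i by (intro dep) (auto simp: part_truncate)
      qed
    qed
    fix i assume i: "Suc i \<le> k"
    then have iS: "Suc i \<in> {1..k}" by simp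
    obtain r where r: "total_additive_ordering (G (Suc i)) r"
      and r_mono: "\<forall>a\<in>partial_sums_below G (Suc i). \<forall>b\<in>partial_sums_below G (Suc i).
               \<forall>x1\<in>G (Suc i). \<forall>x2\<in>G (Suc i). \<forall>y1\<in>G (Suc i). \<forall>y2\<in>G (Suc i).
                 (x1, x2) \<in> r \<longrightarrow> (y1, y2) \<in> r \<longrightarrow>
                 (part (Suc i) (T (a + x1) (b + y1)), part (Suc i) (T (a + x2) (b + y2))) \<in> r"
      using levels[rule_format, OF iS, THEN conjunct2] by (elim exE conjE) (rule that)
    have part_T: "part (Suc i) (T (truncate i x + part (Suc i) x) (truncate i y + part (Suc i) y)) =
        part (Suc i) (T x y)" for x y
      unfolding truncate_Suc[symmetric] using i by (intro dep[OF iS]) (auto simp: part_truncate)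
    have "level_monotone i r T"
      unfolding level_monotone_def
    proof (intro allI impI)
      fix x x' y y'
      assume trunc: "truncate i x = truncate i x'" "truncate i y = truncate i y'"
        and le: "(part (Suc i) x, part (Suc i) x') \<in> r" "(part (Suc i) y, part (Suc i) y') \<in> r"
      have "(part (Suc i) (T (truncate i x + part (Suc i) x) (truncate i y + part (Suc i) y)),
          part (Suc i) (T (truncate i x + part (Suc i) x') (truncate i y + part (Suc i) y'))) \<in> r"
        using r_mono le truncate_in_partial_sums[of i x] truncate_in_partial_sums[of i y] part_in[OF iS] i
        by simp
      then show "(part (Suc i) (T x y), part (Suc i) (T x' y')) \<in> r"
        using part_T[of x y] part_T[of x' y'] trunc by simp
    qed
    with r show "\<exists>r. total_additive_ordering (G (Suc i)) r \<and> level_monotone i r T" by blast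
  qed
qed

section \<open>The Knothe coupling\<close>

text \<open>The induction step on the number of summands. Write \<open>C\<close> for the pair of truncations
  at level \<open>i\<close>. Given \<open>C\<close>, the coupling is monotone in the new
  coordinate, and the exchange inequality compares the entropies of \<open>(C, T)\<close> and
  \<open>(C, T')\<close> with those of \<open>(C, x)\<close> and \<open>(C, y)\<close>.
  Conditioning on \<open>C\<close> instead of on the truncated value of \<open>T\<close> is
  favourable, as the former determines the latter; conditioning \<open>x\<close> on
  \<open>C\<close> instead of on its own truncation changes nothing, by the conditional
  independence built into the coupling.\<close>

lemma (in ordered_level) entropy_level_step:
  assumes T: "level_monotone i r T" "triangular T" "translation_equivariant T"
    and T': "translation_equivariant T'" "complementing T T'"
    and fin: "finite (set_pmf \<mu>)" "finite (set_pmf \<nu>)"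
    and \<pi>\<^sub>0: "is_coupling \<pi>\<^sub>0 (map_pmf (truncate i) \<mu>) (map_pmf (truncate i) \<nu>)"
      "counting_entropy (map_pmf (\<lambda>(x, y). truncate i (T x y)) \<pi>\<^sub>0) +
       counting_entropy (map_pmf (\<lambda>(x, y). truncate i (T' x y)) \<pi>\<^sub>0) \<le>
       counting_entropy (map_pmf (truncate i) \<mu>) + counting_entropy (map_pmf (truncate i) \<nu>)"
  shows "\<exists>\<pi>. is_coupling \<pi> (map_pmf (truncate (Suc i)) \<mu>) (map_pmf (truncate (Suc i)) \<nu>) \<and>
      counting_entropy (map_pmf (\<lambda>(x, y). truncate (Suc i) (T x y)) \<pi>) +
      counting_entropy (map_pmf (\<lambda>(x, y). truncate (Suc i) (T' x y)) \<pi>) \<le>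
      counting_entropy (map_pmf (truncate (Suc i)) \<mu>) + counting_entropy (map_pmf (truncate (Suc i)) \<nu>)"
proof -
  define \<mu>' \<nu>' where "\<mu>' = map_pmf (truncate (Suc i)) \<mu>" and "\<nu>' = map_pmf (truncate (Suc i)) \<nu>"
  have i: "i \<le> k" using level by simp
  have T'_mono: "level_monotone i r T'" and T'_tri: "triangular T'"
    using level_monotone_complement[OF T(1,3) T'(2)] triangular_complement[OF T(2) T'(2)] .
  have tt: "truncate i (truncate (Suc i) x) = truncate i x" for x
    using level by (intro truncate_truncate) auto
  have S: "map_pmf (truncate i) \<mu>' = map_pmf (truncate i) \<mu>" "map_pmf (truncate i) \<nu>' = map_pmf (truncate i) \<nu>"
    by (simp_all add: \<mu>'_def \<nu>'_def map_pmf_comp tt)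
  have fin': "finite (set_pmf \<mu>')" "finite (set_pmf \<nu>')"
    using fin by (simp_all add: \<mu>'_def \<nu>'_def)
  define le where "le x y \<longleftrightarrow> (coord x, coord y) \<in> r" for x y
  have le_total': "le x y \<or> le y x" for x y
    by (simp add: le_def le_total c_in)
  have le_trans': "le x y \<Longrightarrow> le y z \<Longrightarrow> le x z" for x y z
    unfolding le_def by (rule le_trans)
  obtain \<pi> where coupling: "is_coupling \<pi> \<mu>' \<nu>'"
    and base: "map_pmf (\<lambda>(x, y). (truncate i x, truncate i y)) \<pi> = \<pi>\<^sub>0"
    and mono: "\<And>x y x' y'. (x, y) \<in> set_pmf \<pi> \<Longrightarrow> (x', y') \<in> set_pmf \<pi> \<Longrightarrow>
      truncate i x = truncate i x' \<Longrightarrow> truncate i y = truncate i y' \<Longrightarrow>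
      le x x' \<and> le y y' \<or> le x' x \<and> le y' y"
    and indep_x: "\<And>x y. (x, y) \<in> set_pmf \<pi> \<Longrightarrow>
      pmf (map_pmf (\<lambda>(x, y). ((truncate i x, truncate i y), x)) \<pi>) ((truncate i x, truncate i y), x) *
        pmf (map_pmf (truncate i) \<mu>') (truncate i x) = pmf \<pi>\<^sub>0 (truncate i x, truncate i y) * pmf \<mu>' x"
    and indep_y: "\<And>x y. (x, y) \<in> set_pmf \<pi> \<Longrightarrow>
      pmf (map_pmf (\<lambda>(x, y). ((truncate i x, truncate i y), y)) \<pi>) ((truncate i x, truncate i y), y) *
        pmf (map_pmf (truncate i) \<nu>') (truncate i y) = pmf \<pi>\<^sub>0 (truncate i x, truncate i y) * pmf \<nu>' y"
    by (rule knothe_gluing[OF fin', of \<pi>\<^sub>0 "truncate i" le])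
      (use \<pi>\<^sub>0(1) S le_total' in \<open>simp_all\<close>, erule (1) le_trans')
  have fst_\<pi>: "map_pmf fst \<pi> = \<mu>'" and snd_\<pi>: "map_pmf snd \<pi> = \<nu>'"
    using coupling by (auto simp: is_coupling_def)
  have fin_\<pi>: "finite (set_pmf \<pi>)"
  proof (rule finite_subset)
    show "set_pmf \<pi> \<subseteq> set_pmf \<mu>' \<times> set_pmf \<nu>'"
      unfolding fst_\<pi>[symmetric] snd_\<pi>[symmetric] by force
  qed (use fin' in simp)
  have supp: "truncate (Suc i) (fst \<omega>) = fst \<omega>" "truncate (Suc i) (snd \<omega>) = snd \<omega>" if "\<omega> \<in> set_pmf \<pi>" for \<omega>
  proof -
    have "fst \<omega> \<in> set_pmf \<mu>'" "snd \<omega> \<in> set_pmf \<nu>'"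
      using that unfolding fst_\<pi>[symmetric] snd_\<pi>[symmetric] by auto
    then show "truncate (Suc i) (fst \<omega>) = fst \<omega>" "truncate (Suc i) (snd \<omega>) = snd \<omega>"
      using level by (auto simp: \<mu>'_def \<nu>'_def truncate_truncate)
  qed
  define C where "C = (\<lambda>\<omega>. (truncate i (fst \<omega>), truncate i (snd \<omega>)))"
  define op where "op U j = (\<lambda>\<omega>. truncate j (U (fst \<omega>) (snd \<omega>)))" for U :: "'a \<Rightarrow> 'a \<Rightarrow> 'a" and j
  let ?h = "\<lambda>f. counting_entropy (map_pmf f \<pi>)"
  \<comment> \<open>Two support points with the same \<open>C\<close> and the same value of \<open>U\<close> share an argument: otherwise
    the chain property makes both coordinates increase strictly, and \<open>U\<close> with them.\<close>
  have share: "fst \<omega> = fst \<omega>' \<or> snd \<omega> = snd \<omega>'"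
    if U: "level_monotone i r U" "translation_equivariant U"
      and \<omega>: "\<omega> \<in> set_pmf \<pi>" "\<omega>' \<in> set_pmf \<pi>" and eq: "C \<omega> = C \<omega>'" "op U (Suc i) \<omega> = op U (Suc i) \<omega>'"
    for U \<omega> \<omega>'
  proof (rule ccontr)
    assume "\<not> ?thesis"
    then have ne: "fst \<omega> \<noteq> fst \<omega>'" "snd \<omega> \<noteq> snd \<omega>'" by auto
    have trunc: "truncate i (fst \<omega>) = truncate i (fst \<omega>')" "truncate i (snd \<omega>) = truncate i (snd \<omega>')"
      using eq(1) by (auto simp: C_def)
    have c_ne: "coord (fst \<omega>) \<noteq> coord (fst \<omega>')" "coord (snd \<omega>) \<noteq> coord (snd \<omega>')"
      using ne trunc supp[OF \<omega>(1)] supp[OF \<omega>(2)] by (auto simp: truncate_Suc)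
    have "coord (U (fst \<omega>) (snd \<omega>)) = coord (U (fst \<omega>') (snd \<omega>'))"
      using eq(2) level unfolding op_def by (simp add: truncate_eq_iff)
    moreover have "le (fst \<omega>) (fst \<omega>') \<and> le (snd \<omega>) (snd \<omega>') \<or> le (fst \<omega>') (fst \<omega>) \<and> le (snd \<omega>') (snd \<omega>)"
      using mono[of "fst \<omega>" "snd \<omega>" "fst \<omega>'" "snd \<omega>'"] \<omega> trunc by simp
    ultimately show False
      using strict_level_increase[OF U trunc _ _ c_ne]
        strict_level_increase[OF U trunc[symmetric] _ _ c_ne[symmetric]] by (auto simp: le_def)
  qed
  have sum_op: "op T (Suc i) \<omega> + op T' (Suc i) \<omega> = fst \<omega> + snd \<omega>" if "\<omega> \<in> set_pmf \<pi>" for \<omega>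
  proof -
    have "op T (Suc i) \<omega> + op T' (Suc i) \<omega> = truncate (Suc i) (fst \<omega>) + truncate (Suc i) (snd \<omega>)"
      using T'(2) level by (simp add: op_def truncate_add[symmetric] complementing_def)
    then show ?thesis using supp[OF that] by simp
  qed
  have exchange: "?h (\<lambda>\<omega>. (C \<omega>, op T (Suc i) \<omega>)) + ?h (\<lambda>\<omega>. (C \<omega>, op T' (Suc i) \<omega>)) \<le>
      ?h (\<lambda>\<omega>. (C \<omega>, fst \<omega>)) + ?h (\<lambda>\<omega>. (C \<omega>, snd \<omega>))"
  proof (rule counting_entropy_exchange[OF fin_\<pi>])
    fix \<omega> \<omega>' assume \<omega>: "\<omega> \<in> set_pmf \<pi>" "\<omega>' \<in> set_pmf \<pi>"
    show "fst \<omega> = fst \<omega>' \<or> snd \<omega> = snd \<omega>'" if "C \<omega> = C \<omega>'" "op T (Suc i) \<omega> = op T (Suc i) \<omega>'"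
      using share[OF T(1,3) \<omega> that] .
    show "fst \<omega> = fst \<omega>' \<or> snd \<omega> = snd \<omega>'" if "C \<omega> = C \<omega>'" "op T' (Suc i) \<omega> = op T' (Suc i) \<omega>'"
      using share[OF T'_mono T'(1) \<omega> that] .
    show "C \<omega> = C \<omega>' \<and> op T (Suc i) \<omega> = op T (Suc i) \<omega>' \<and> op T' (Suc i) \<omega> = op T' (Suc i) \<omega>'"
      if "fst \<omega> = fst \<omega>'" "snd \<omega> = snd \<omega>'"
      using that by (simp add: C_def op_def)
    show "fst \<omega> = fst \<omega>' \<longleftrightarrow> snd \<omega> = snd \<omega>'"
      if "op T (Suc i) \<omega> = op T (Suc i) \<omega>'" "op T' (Suc i) \<omega> = op T' (Suc i) \<omega>'"
    proof -
      have "fst \<omega> + snd \<omega> = fst \<omega>' + snd \<omega>'"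
        using sum_op[OF \<omega>(1)] sum_op[OF \<omega>(2)] that by simp
      then show ?thesis by auto
    qed
  qed
  have op_base: "?h (op U i) = counting_entropy (map_pmf (\<lambda>(x, y). truncate i (U x y)) \<pi>\<^sub>0)"
    if "triangular U" for U
  proof -
    have "(\<lambda>(x, y). truncate i (U x y)) \<circ> (\<lambda>(x, y). (truncate i x, truncate i y)) = op U i"
      using triangularD[OF that i] by (auto simp: op_def)
    then show ?thesis
      unfolding base[symmetric] pmf.map_comp by simp
  qed
  \<comment> \<open>Conditioning on more information: \<open>C\<close> determines the truncated value \<open>op U i\<close>.\<close>
  have condition: "?h (op U (Suc i)) + ?h C \<le> ?h (\<lambda>\<omega>. (C \<omega>, op U (Suc i) \<omega>)) + ?h (op U i)"
    if "triangular U" for U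
  proof (rule counting_entropy_supermodular[OF fin_\<pi>])
    fix \<omega> \<omega>' :: "'a \<times> 'a"
    show "(C \<omega>, op U (Suc i) \<omega>) = (C \<omega>', op U (Suc i) \<omega>') \<longleftrightarrow>
        op U (Suc i) \<omega> = op U (Suc i) \<omega>' \<and> C \<omega> = C \<omega>'" by auto
    show "op U i \<omega> = op U i \<omega>'" if "op U (Suc i) \<omega> = op U (Suc i) \<omega>'"
      using that unfolding op_def by (rule truncate_SucD[OF level])
    show "op U i \<omega> = op U i \<omega>'" if "C \<omega> = C \<omega>'"
      using that triangularD[OF \<open>triangular U\<close> i, of "fst \<omega>" "snd \<omega>"]
        triangularD[OF \<open>triangular U\<close> i, of "fst \<omega>'" "snd \<omega>'"] by (simp add: op_def C_def)
  qed
  have C_\<pi>: "map_pmf C \<pi> = \<pi>\<^sub>0"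
    using base by (simp add: C_def split_def)
  have fst_i: "map_pmf (\<lambda>\<omega>. truncate i (fst \<omega>)) \<pi> = map_pmf (truncate i) \<mu>'"
    and snd_i: "map_pmf (\<lambda>\<omega>. truncate i (snd \<omega>)) \<pi> = map_pmf (truncate i) \<nu>'"
    by (simp_all add: fst_\<pi>[symmetric] snd_\<pi>[symmetric] map_pmf_comp)
  have "?h (\<lambda>\<omega>. (C \<omega>, fst \<omega>)) + ?h (\<lambda>\<omega>. truncate i (fst \<omega>)) = ?h C + ?h fst"
  proof (rule counting_entropy_modular[OF fin_\<pi>])
    fix \<omega> assume "\<omega> \<in> set_pmf \<pi>"
    then show "pmf (map_pmf (\<lambda>\<omega>. (C \<omega>, fst \<omega>)) \<pi>) (C \<omega>, fst \<omega>) *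
        pmf (map_pmf (\<lambda>\<omega>. truncate i (fst \<omega>)) \<pi>) (truncate i (fst \<omega>)) =
        pmf (map_pmf C \<pi>) (C \<omega>) * pmf (map_pmf fst \<pi>) (fst \<omega>)"
      using indep_x[of "fst \<omega>" "snd \<omega>"] by (simp add: C_\<pi> fst_i fst_\<pi>) (simp add: C_def split_def)
  qed
  moreover have "?h (\<lambda>\<omega>. (C \<omega>, snd \<omega>)) + ?h (\<lambda>\<omega>. truncate i (snd \<omega>)) = ?h C + ?h snd"
  proof (rule counting_entropy_modular[OF fin_\<pi>])
    fix \<omega> assume "\<omega> \<in> set_pmf \<pi>"
    then show "pmf (map_pmf (\<lambda>\<omega>. (C \<omega>, snd \<omega>)) \<pi>) (C \<omega>, snd \<omega>) *
        pmf (map_pmf (\<lambda>\<omega>. truncate i (snd \<omega>)) \<pi>) (truncate i (snd \<omega>)) =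
        pmf (map_pmf C \<pi>) (C \<omega>) * pmf (map_pmf snd \<pi>) (snd \<omega>)"
      using indep_y[of "fst \<omega>" "snd \<omega>"] by (simp add: C_\<pi> snd_i snd_\<pi>) (simp add: C_def split_def)
  qed
  moreover have "?h (op T i) + ?h (op T' i) \<le> ?h (\<lambda>\<omega>. truncate i (fst \<omega>)) + ?h (\<lambda>\<omega>. truncate i (snd \<omega>))"
    using \<pi>\<^sub>0(2) by (simp add: op_base T(2) T'_tri fst_i snd_i S)
  ultimately have "?h (op T (Suc i)) + ?h (op T' (Suc i)) \<le> ?h fst + ?h snd"
    using exchange condition[OF T(2)] condition[OF T'_tri] by linarith
  then have "counting_entropy (map_pmf (\<lambda>(x, y). truncate (Suc i) (T x y)) \<pi>) +
      counting_entropy (map_pmf (\<lambda>(x, y). truncate (Suc i) (T' x y)) \<pi>) \<le>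
      counting_entropy \<mu>' + counting_entropy \<nu>'"
    by (simp add: fst_\<pi> snd_\<pi> op_def split_def)
  with coupling show ?thesis
    unfolding \<mu>'_def \<nu>'_def by blast
qed

text \<open>The induction runs over the truncations, from level \<open>0\<close>, where all laws are point
  masses and both sides vanish, up to level \<open>k\<close>, where the truncation is the
  identity.\<close>

theorem knothe_coupling_entropy:
  fixes T T' :: "'a::ab_group_add \<Rightarrow> 'a \<Rightarrow> 'a"
  assumes compl: "complementing T T'"
    and equiv: "translation_equivariant T" "translation_equivariant T'"
    and knothe: "knothe_monotone T"
    and fin: "finite (set_pmf \<mu>)" "finite (set_pmf \<nu>)"
  shows "\<exists>\<pi>. is_coupling \<pi> \<mu> \<nu> \<and>
    counting_entropy (map_pmf (\<lambda>(x, y). T x y) \<pi>) + counting_entropy (map_pmf (\<lambda>(x, y). T' x y) \<pi>) \<le>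
    counting_entropy \<mu> + counting_entropy \<nu>"
proof -
  obtain k G where "direct_sum k G" and tri: "direct_sum.triangular k G T"
    and levels: "\<And>i. Suc i \<le> k \<Longrightarrow>
      \<exists>r. total_additive_ordering (G (Suc i)) r \<and> direct_sum.level_monotone k G i r T"
    using knothe_monotone_level[OF knothe] by blast
  then interpret direct_sum k G by blast
  have "\<exists>\<pi>. is_coupling \<pi> (map_pmf (truncate i) \<mu>) (map_pmf (truncate i) \<nu>) \<and>
      counting_entropy (map_pmf (\<lambda>(x, y). truncate i (T x y)) \<pi>) +
      counting_entropy (map_pmf (\<lambda>(x, y). truncate i (T' x y)) \<pi>) \<le>
      counting_entropy (map_pmf (truncate i) \<mu>) + counting_entropy (map_pmf (truncate i) \<nu>)"
    if "i \<le> k" for i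
    using that
  proof (induction i)
    case 0
    have t0: "truncate 0 = (\<lambda>_. 0)" by auto
    have "is_coupling (return_pmf (0, 0)) (map_pmf (truncate 0) \<mu>) (map_pmf (truncate 0) \<nu>)"
      by (simp add: t0 is_coupling_def map_pmf_const)
    then show ?case
      by (intro exI[of _ "return_pmf (0, 0)"]) (simp add: t0 map_pmf_const)
  next
    case (Suc i)
    obtain r where r: "total_additive_ordering (G (Suc i)) r" "level_monotone i r T"
      using levels[OF Suc.prems] by blast
    interpret ordered_level k G i r
      using Suc.prems r(1) by unfold_locales
    obtain \<pi>\<^sub>0 where \<pi>\<^sub>0: "is_coupling \<pi>\<^sub>0 (map_pmf (truncate i) \<mu>) (map_pmf (truncate i) \<nu>)"
      "counting_entropy (map_pmf (\<lambda>(x, y). truncate i (T x y)) \<pi>\<^sub>0) +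
       counting_entropy (map_pmf (\<lambda>(x, y). truncate i (T' x y)) \<pi>\<^sub>0) \<le>
       counting_entropy (map_pmf (truncate i) \<mu>) + counting_entropy (map_pmf (truncate i) \<nu>)"
      using Suc.IH Suc.prems by auto
    show ?case
      by (rule entropy_level_step[OF r(2) tri equiv(1,2) compl fin \<pi>\<^sub>0])
  qed
  from this[OF order_refl] show ?thesis
    by (simp add: truncate_all cong: map_pmf_cong)
qed

theorem theorem1p4:
  fixes T_minus T_plus :: "int ^ 'n \<Rightarrow> int ^ 'n \<Rightarrow> int ^ 'n"
    and \<mu> \<nu> :: "(int ^ 'n) pmf"
  assumes "complementing T_minus T_plus"
    and "translation_equivariant T_minus" and "translation_equivariant T_plus"
    and "knothe_monotone T_minus" and "knothe_monotone T_plus"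
    and "finite (set_pmf \<mu>)" and "finite (set_pmf \<nu>)"
  shows "\<exists>\<pi>. is_coupling \<pi> \<mu> \<nu> \<and>
    counting_entropy \<mu> + counting_entropy \<nu> \<ge>
      counting_entropy (map_pmf (\<lambda>(x, y). T_minus x y) \<pi>) +
      counting_entropy (map_pmf (\<lambda>(x, y). T_plus x y) \<pi>)"
  using knothe_coupling_entropy[OF assms(1,2,3,4,6,7)] .

end
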